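(* Let $T$ be a tree with $t$ edges and let $G=(V,E)$ be an $n$-vertex graph with average degree $d$ and minimum degree at least $t$. Then the number of isomorphic (labeled) copies of $T$ in $G$ is at least $$nd \prod_{v \in V} (d(v) - t + 1)^{\frac{(t-1)d(v)}{nd}}.$$
   Context: Graphs are finite, simple and undirected. For a vertex $v$ of $G=(V,E)$, $d(v)$ denotes the degree of $v$ in $G$. The average degree is $d = \frac{1}{n}\sum_{v\in V} d(v) = 2|E|/n$, a real number, so that $nd = 2|E|$. The number of isomorphic (labeled) copies of $T$ in $G$ is the number of injections $\phi: V(T)\to V$ such that $\phi(u)\phi(v)\in E$ for every edge $uv$ of $T$ (the image need not be an induced subgraph). The exponents in the product are real numbers. *)

theory Defs
  imports
    Complex_Main
    "HOL-Library.FuncSet"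
    "Graph_Theory.Pair_Digraph"
    "Graph_Theory.Digraph_Component"
begin

text \<open>
  A finite simple undirected graph is a \<^locale>\<open>pair_graph\<close>, i.e. a finite loop-free
  symmetric digraph whose arcs are ordered pairs of vertices. Each undirected edge thus
  corresponds to two opposite arcs, and the degree of a vertex is its out-degree.
\<close>

abbreviation vdegree :: "'a pair_pre_digraph \<Rightarrow> 'a \<Rightarrow> nat" where
  "vdegree G v \<equiv> out_degree (with_proj G) v"

definition uedges :: "'a pair_pre_digraph \<Rightarrow> 'a set set" where
  "uedges G = {{u, v} | u v. (u, v) \<in> parcs G}"

text \<open>
  The library's \<^const>\<open>tree\<close> is not the undirected notion: in a symmetric digraph
  \<^const>\<open>pre_digraph.cycle\<close> counts traversing an edge back and forth as a cycle.
  Such closed walks have length 2, and the cycles of length at least 3 in a symmetric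
  digraph without loops and parallel arcs are exactly the cycles of the undirected graph.
  Note that \<^const>\<open>connected\<close> includes having at least one vertex.
\<close>

definition undirected_tree :: "'a pair_pre_digraph \<Rightarrow> bool" where
  "undirected_tree T \<longleftrightarrow>
     pair_graph T \<and> connected (with_proj T) \<and>
     \<not> (\<exists>p. pre_digraph.cycle (with_proj T) p \<and> length p \<ge> 3)"

definition average_degree :: "'a pair_pre_digraph \<Rightarrow> real" where
  "average_degree G = (\<Sum>v\<in>pverts G. real (vdegree G v)) / real (card (pverts G))"

text \<open>
  The maps are extensional, so that each injection is represented by exactly one
  function on the whole vertex type.
\<close>

definition labeled_copies ::
    "'b pair_pre_digraph \<Rightarrow> 'a pair_pre_digraph \<Rightarrow> ('b \<Rightarrow> 'a) set" where
  "labeled_copies T G =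
     {\<phi> \<in> pverts T \<rightarrow>\<^sub>E pverts G. inj_on \<phi> (pverts T) \<and>
        (\<forall>(u, v) \<in> parcs T. (\<phi> u, \<phi> v) \<in> parcs G)}"

end

theory Submission
  imports Defs
begin

text \<open>
  Consider a random copy of \<open>T\<close> in \<open>G\<close> that sends every edge of \<open>T\<close> to a uniformly random
  arc of \<open>G\<close>. It sends every vertex of \<open>T\<close> to \<open>v\<close> with probability \<open>d(v) / (n d)\<close>, and there are
  at least \<open>exp H\<close> copies, where \<open>H\<close> is its entropy. The first edge contributes \<open>ln (n d)\<close> to
  \<open>H\<close>. If attaching each of the other \<open>t - 1\<close> vertices to a vertex at \<open>v\<close> contributed
  \<open>ln (d(v) - t + 1)\<close>, averaging over the uniform edges would give exactly the claimed bound.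
  Attaching it at a uniformly random unused neighbour of \<open>v\<close> achieves this contribution, but the
  edges do not stay uniform: neighbours that are likely to be in use already are hit too
  rarely.

  The remedy is to avoid the used vertices one at a time. List the embedded vertices in an
  order that starts with the vertex to which the leaf is attached and in which every initial segment
  is a subtree. Given the position of the first vertex alone, the leaf is uniform on its
  neighbours. Suppose that the law of the leaf given an initial segment is known and avoids this
  segment. Given the segment, the next vertex of the list and the leaf have two conditional laws;
  they are coupled so that the two vertices never coincide. This changes neither of the two laws,
  so in the end the leaf avoids all embedded vertices, their joint law is the
  old one, and the new edge is uniform.

  The coupling is the lemma \<open>separating_density\<close>. It needs conditional probabilities of at most
  \<open>1/q\<close> with \<open>q \<ge> 2\<close>, it multiplies them by at most \<open>q / (q - 1)\<close>, and if the leaf takes each value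
  with probability at most \<open>l\<close> it loses entropy at most \<open>q l ln (q / (q - 1))\<close>. Given a segment
  with \<open>a \<ge> 1\<close> edges, the conditional probabilities turn out to be at most \<open>1 / (t - a)\<close>, and the
  factor for \<open>q = t - a\<close> turns this into \<open>1 / (t - (a + 1))\<close>, which is what the next
  coupling needs. The conditional laws that occur must have been controlled when earlier vertices
  were attached. This is the case if the vertices of \<open>T\<close> are attached in depth-first order,
  and \<open>law_Suc\<close> carries out the induction.

  For the entropy, let \<open>k = t - 1\<close>. Attaching a vertex at \<open>v\<close> to a tree with \<open>s\<close> edges contributes
  at least \<open>ln (d(v) - 1) - k / (d(v) - 1) * ln (k / (t - s))\<close>. The sum over \<open>1 \<le> s \<le> k\<close> is
  \<open>k ln (d(v) - 1) - k / (d(v) - 1) * ln (k^k / k!)\<close>, and \<open>k! \<ge> e (k / e)^k\<close> shows that this is at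
  least \<open>k ln (d(v) - k)\<close> (\<open>step_entropies\<close>).
\<close>

section \<open>Random pairs that never coincide\<close>

text \<open>
  If an entry is fractional, then so is a second one. Shifting weight from one to the other, in either
  direction and until one of the two becomes 0 or 1, writes the vector as a mixture of two
  vectors with fewer fractional entries.
\<close>

lemma convex_combination_of_sets:
  fixes x :: "'a \<Rightarrow> real" and q :: nat
  assumes "finite W" and "\<And>w. w \<in> W \<Longrightarrow> 0 \<le> x w \<and> x w \<le> 1" and "sum x W = real q"
  shows "\<exists>c :: 'a set \<Rightarrow> real. (\<forall>B. 0 \<le> c B) \<and> (\<Sum>B | B \<subseteq> W \<and> card B = q. c B) = 1 \<and>
    (\<forall>w\<in>W. x w = (\<Sum>B | B \<subseteq> W \<and> card B = q. if w \<in> B then c B else 0))"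
  using assms(2,3)
proof (induction "card {w \<in> W. 0 < x w \<and> x w < 1}" arbitrary: x rule: less_induct)
  case less
  let ?F = "\<lambda>x. {w \<in> W. 0 < x w \<and> x w < (1::real)}"
  let ?Q = "{B. B \<subseteq> W \<and> card B = q}"
  have fin: "finite (?F y)" for y using assms(1) by simp
  have finQ: "finite ?Q" using assms(1) by simp
  show ?case
  proof (cases "?F x = {}")
    case True
    define B where "B = {w \<in> W. x w = 1}"
    have x01: "x w = (if w \<in> B then 1 else 0)" if "w \<in> W" for w
      using True less.prems(1)[OF that] that unfolding B_def by (auto simp: less_le)
    have BW: "B \<subseteq> W" unfolding B_def by auto
    have "sum x W = (\<Sum>w\<in>W. if w \<in> B then 1 else 0)" using x01 by (intro sum.cong) auto
    also have "\<dots> = real (card B)" using assms(1) BW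
      by (simp add: sum.If_cases Int_absorb1)
    finally have cB: "card B = q" using less.prems(2) by simp
    let ?c = "\<lambda>C. if C = B then 1 else (0::real)"
    have *: "(\<Sum>C\<in>?Q. if w \<in> C then ?c C else 0) = (if w \<in> B then 1 else 0)" for w
    proof -
      have "(\<Sum>C\<in>?Q. if w \<in> C then ?c C else 0) = (\<Sum>C\<in>?Q. if C = B then (if w \<in> B then 1 else 0) else 0)"
        by (intro sum.cong) auto
      thus ?thesis using finQ BW cB by (simp add: sum.delta)
    qed
    have "(\<Sum>C\<in>?Q. ?c C) = 1" using finQ BW cB by (simp add: sum.delta)
    with * x01 show ?thesis by (intro exI[of _ ?c]) auto
  next
    case False
    then obtain i where i: "i \<in> W" "0 < x i" "x i < 1" by auto
    \<comment> \<open>Since the total is an integer, a fractional coordinate is never alone.\<close>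
    have "\<exists>j. j \<in> W \<and> j \<noteq> i \<and> 0 < x j \<and> x j < 1"
    proof (rule ccontr)
      assume "\<not> ?thesis"
      hence h: "x w = 0 \<or> x w = 1" if "w \<in> W - {i}" for w
        using that less.prems(1)[of w] by (auto simp: less_le)
      have "sum x (W - {i}) \<in> \<int>" by (rule Ints_sum) (use h in force)
      moreover have "x i = real q - sum x (W - {i})"
        using less.prems(2) assms(1) i(1) by (simp add: sum.remove)
      ultimately have "x i \<in> \<int>" by simp
      then obtain k where "x i = of_int k" by (auto elim: Ints_cases)
      thus False using i by simp
    qed
    then obtain j where j: "j \<in> W" "j \<noteq> i" "0 < x j" "x j < 1" by auto
    define a where "a = min (1 - x i) (x j)"
    define b where "b = min (x i) (1 - x j)"
    have ab: "a > 0" "b > 0" using i j by (auto simp: a_def b_def)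
    define y where "y = x(i := x i + a, j := x j - a)"
    define z where "z = x(i := x i - b, j := x j + b)"
    have sums: "sum y W = sum x W" "sum z W = sum x W"
    proof -
      have "sum f W = f i + f j + sum f (W - {i,j})" for f :: "'a \<Rightarrow> real"
        using assms(1) i(1) j(1,2) by (simp add: sum.remove[of W i] sum.remove[of "W - {i}" j] Diff_insert2[symmetric] insert_commute)
      note s = this
      have r: "sum y (W - {i,j}) = sum x (W - {i,j})" "sum z (W - {i,j}) = sum x (W - {i,j})"
        by (auto simp: y_def z_def intro!: sum.cong)
      show "sum y W = sum x W" unfolding s[of y] s[of x] r using j(2) by (simp add: y_def)
      show "sum z W = sum x W" unfolding s[of z] s[of x] r using j(2) by (simp add: z_def)
    qed
    have bds: "0 \<le> y w \<and> y w \<le> 1" "0 \<le> z w \<and> z w \<le> 1" if "w \<in> W" for w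
      using less.prems(1)[OF that] i j by (auto simp: y_def z_def a_def b_def)
    have "?F y \<subseteq> ?F x" "?F z \<subseteq> ?F x" using i j by (auto simp: y_def z_def a_def b_def split: if_splits)
    moreover have "?F y \<noteq> ?F x"
    proof (cases "a = x j")
      case True hence "j \<notin> ?F y" by (simp add: y_def) thus ?thesis using j by blast
    next
      case False hence "i \<notin> ?F y" using j(2) by (auto simp: y_def a_def min_def split: if_splits)
      thus ?thesis using i by blast
    qed
    moreover have "?F z \<noteq> ?F x"
    proof (cases "b = x i")
      case True hence "i \<notin> ?F z" using j(2) by (simp add: z_def) thus ?thesis using i by blast
    next
      case False hence "j \<notin> ?F z" using j(2) by (auto simp: z_def b_def min_def split: if_splits)
      thus ?thesis using j by blast
    qed
    ultimately have "card (?F y) < card (?F x)" "card (?F z) < card (?F x)"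
      by (auto intro!: psubset_card_mono[OF fin])
    note smaller = this
    have "sum y W = real q" "sum z W = real q" using sums less.prems(2) by simp_all
    with less.hyps[OF smaller(1) bds(1)] less.hyps[OF smaller(2) bds(2)]
    have ex: "\<exists>c. (\<forall>B. 0 \<le> c B) \<and> sum c ?Q = 1 \<and> (\<forall>w\<in>W. y w = (\<Sum>B\<in>?Q. if w \<in> B then c B else 0))"
      "\<exists>c. (\<forall>B. 0 \<le> c B) \<and> sum c ?Q = 1 \<and> (\<forall>w\<in>W. z w = (\<Sum>B\<in>?Q. if w \<in> B then c B else 0))"
      by blast+
    obtain c where c: "\<forall>B. 0 \<le> c B" "sum c ?Q = 1" "\<forall>w\<in>W. y w = (\<Sum>B\<in>?Q. if w \<in> B then c B else 0)"
      using ex(1) by blast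
    obtain d where d: "\<forall>B. 0 \<le> d B" "sum d ?Q = 1" "\<forall>w\<in>W. z w = (\<Sum>B\<in>?Q. if w \<in> B then d B else 0)"
      using ex(2) by blast
    define p where "p = b / (a + b)"
    have p: "0 \<le> p" "p \<le> 1" using ab by (auto simp: p_def field_simps)
    have p1: "1 - p = a / (a + b)" using ab by (simp add: p_def field_simps)
    have "p * a = (1 - p) * b" unfolding p1 by (simp add: p_def)
    hence xyz: "x w = p * y w + (1 - p) * z w" for w
      using j(2) by (auto simp: y_def z_def algebra_simps)
    let ?e = "\<lambda>B. p * c B + (1 - p) * d B"
    have "\<forall>B. 0 \<le> ?e B" using p c d by auto
    moreover have "sum ?e ?Q = 1" using c d by (simp add: sum.distrib sum_distrib_left[symmetric])
    moreover have "x w = (\<Sum>B\<in>?Q. if w \<in> B then ?e B else 0)" if "w \<in> W" for w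
    proof -
      have "(\<Sum>B\<in>?Q. if w \<in> B then ?e B else 0) =
        (\<Sum>B\<in>?Q. p * (if w \<in> B then c B else 0) + (1-p) * (if w \<in> B then d B else 0))"
        by (intro sum.cong) auto
      also have "\<dots> = p * y w + (1 - p) * z w" using c(3) d(3) that
        by (simp add: sum.distrib sum_distrib_left[symmetric])
      finally show ?thesis using xyz by simp
    qed
    ultimately show ?thesis by (intro exI[of _ ?e]) auto
  qed
qed

text \<open>
  The convention \<open>ln 0 = 0\<close> gives \<open>0 ln 0 = 0\<close>, so sums of this function over the probabilities of a
  finite law are negative entropies even if some probabilities vanish.
\<close>

definition xlnx :: "real \<Rightarrow> real" where "xlnx x = x * ln x"

lemma xlnx_simps [simp]: "xlnx 0 = 0" "xlnx 1 = 0" by (simp_all add: xlnx_def)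

lemma xlnx_mult: "0 \<le> x \<Longrightarrow> 0 \<le> y \<Longrightarrow> xlnx (x * y) = y * xlnx x + x * xlnx y"
  by (cases "x = 0"; cases "y = 0") (auto simp: xlnx_def ln_mult algebra_simps)

lemma xlnx_tangent: "0 \<le> x \<Longrightarrow> 0 < y \<Longrightarrow> xlnx x \<ge> xlnx y + (1 + ln y) * (x - y)"
proof (cases "x = 0")
  case True assume "0 < y" with True show ?thesis by (simp add: xlnx_def algebra_simps)
next
  case False assume "0 \<le> x" "0 < y"
  with False have x: "x > 0" by simp
  have "ln (y / x) \<le> y / x - 1" using x \<open>0 < y\<close> by (intro ln_le_minus_one) auto
  hence "x * (ln y - ln x) \<le> x * (y / x - 1)" using x \<open>0<y\<close> by (intro mult_left_mono) (auto simp: ln_div)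
  also have "\<dots> = y - x" using x by (simp add: field_simps)
  finally show ?thesis by (simp add: xlnx_def algebra_simps)
qed

lemma xlnx_jensen:
  assumes "finite S" "\<And>s. s \<in> S \<Longrightarrow> 0 \<le> p s" "sum p S = 1" "\<And>s. s \<in> S \<Longrightarrow> 0 \<le> x s"
  shows "xlnx (\<Sum>s\<in>S. p s * x s) \<le> (\<Sum>s\<in>S. p s * xlnx (x s))"
proof -
  define m where "m = (\<Sum>s\<in>S. p s * x s)"
  have m0: "m \<ge> 0" unfolding m_def using assms by (intro sum_nonneg) auto
  show ?thesis
  proof (cases "m = 0")
    case True
    hence "p s * x s = 0" if "s \<in> S" for s
      using that assms sum_nonneg_eq_0_iff[of S "\<lambda>s. p s * x s"] unfolding m_def by auto
    hence "p s * xlnx (x s) = 0" if "s \<in> S" for s using that by (auto simp: xlnx_def)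
    hence "(\<Sum>s\<in>S. p s * xlnx (x s)) = 0" by (intro sum.neutral) blast
    thus ?thesis using True m_def by simp
  next
    case False
    hence "m > 0" using m0 by simp
    have "(\<Sum>s\<in>S. p s * (xlnx m + (1 + ln m) * (x s - m))) \<le> (\<Sum>s\<in>S. p s * xlnx (x s))"
      using assms \<open>m > 0\<close> by (intro sum_mono mult_left_mono xlnx_tangent) auto
    also have "(\<Sum>s\<in>S. p s * (xlnx m + (1 + ln m) * (x s - m))) =
       (\<Sum>s\<in>S. p s * (xlnx m - (1 + ln m) * m) + (1 + ln m) * (p s * x s))"
      by (intro sum.cong) (auto simp: algebra_simps)
    also have "\<dots> = xlnx m"
      using assms(3) by (simp add: sum.distrib sum_distrib_right[symmetric] sum_distrib_left[symmetric] m_def[symmetric])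
    finally show ?thesis unfolding m_def .
  qed
qed

text \<open>
  Here \<open>\<rho>\<close> is the density, relative to independence, of the joint law of a random \<open>z\<close> with law \<open>\<nu>\<close> and a
  uniformly random \<open>w\<close> in \<open>B\<close> that are never equal. Each \<open>w'\<close> in \<open>B\<close> marks a part of mass \<open>l\<close> of \<open>\<nu>\<close>
  that contains all of the mass at \<open>w'\<close>; the missing mass \<open>l - \<nu> w'\<close> is taken from outside of \<open>B\<close>. If \<open>z\<close> is
  marked by \<open>w'\<close>, then \<open>w\<close> is uniform on \<open>B - {w'}\<close>, and if \<open>z\<close> is unmarked, then \<open>w\<close> is uniform on
  \<open>B\<close>. All marks have the same mass, so \<open>w\<close> is uniform on \<open>B\<close> overall. Only the marked part, which has mass
  \<open>q l\<close>, departs from independence, and there the density is at most \<open>\<kappa>\<close>.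
\<close>

lemma separate_from_uniform:
  fixes \<nu> :: "'a \<Rightarrow> real"
  assumes "finite X" "B \<subseteq> X" "card B = q" "q \<ge> 2"
    and nonneg: "\<And>z. z \<in> X \<Longrightarrow> 0 \<le> \<nu> z" and le: "\<And>z. z \<in> X \<Longrightarrow> \<nu> z \<le> l"
    and one: "sum \<nu> X = 1" and ql: "real q * l \<le> 1"
  defines "\<kappa> \<equiv> real q / real (q - 1)"
  shows "\<exists>\<rho>. (\<forall>z\<in>X. \<forall>w\<in>B. 0 \<le> \<rho> z w \<and> \<rho> z w \<le> \<kappa>) \<and> (\<forall>w\<in>B. \<rho> w w = 0) \<and>
    (\<forall>w\<in>B. (\<Sum>z\<in>X. \<nu> z * \<rho> z w) = 1) \<and> (\<forall>z\<in>X. (\<Sum>w\<in>B. \<rho> z w) = real q) \<and>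
    (\<Sum>w\<in>B. \<Sum>z\<in>X. \<nu> z * xlnx (\<rho> z w)) \<le> real q * (real q * l * ln \<kappa>)"
proof -
  have finB: "finite B" using assms(1,2) by (rule finite_subset[rotated])
  define out where "out = sum \<nu> (X - B)"
  \<comment> \<open>A point outside of \<open>B\<close> is marked by \<open>w\<close> with probability \<open>\<tau> w\<close>.\<close>
  define \<tau> where "\<tau> w = (l - \<nu> w) / out" for w
  define T where "T = sum \<tau> B"
  define \<rho> where "\<rho> z w = (if z \<in> B then (if z = w then 0 else \<kappa>)
     else (1 - T) + (\<Sum>w'\<in>B. \<tau> w' * (if w' = w then 0 else \<kappa>)))" for z w
  have k: "\<kappa> \<ge> 1" "\<kappa> * (real q - 1) = real q" using \<open>q \<ge> 2\<close>
    by (auto simp: \<kappa>_def field_simps of_nat_diff)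
  have split: "sum f X = sum f B + sum f (X - B)" for f :: "'a \<Rightarrow> real"
    using assms(1,2) by (metis add.commute sum.subset_diff)
  have out0: "out \<ge> 0" unfolding out_def using nonneg by (intro sum_nonneg) auto
  have B1: "sum \<nu> B = 1 - out" using split[of \<nu>] one by (simp add: out_def)
  \<comment> \<open>If there is no mass outside of \<open>B\<close>, then \<open>q l \<le> 1\<close> forces mass \<open>l\<close> at every point of \<open>B\<close>.\<close>
  have tau_mass: "out * \<tau> w = l - \<nu> w" if "w \<in> B" for w
  proof (cases "out = 0")
    case True
    have "(\<Sum>w\<in>B. l - \<nu> w) \<le> 0" using True B1 ql assms(3) by (simp add: sum_subtractf)
    moreover have "\<forall>w\<in>B. 0 \<le> l - \<nu> w" using le assms(2) by auto
    ultimately have "l - \<nu> w = 0"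
      using that finB by (metis (no_types, lifting) antisym sum_nonneg sum_nonneg_eq_0_iff)
    thus ?thesis using True by simp
  qed (simp add: \<tau>_def)
  have tau0: "\<tau> w \<ge> 0" if "w \<in> B" for w unfolding \<tau>_def using that le assms(2) out0 by auto
  have outT: "out * T = real q * l - (1 - out)"
    unfolding T_def sum_distrib_left using tau_mass assms(3) B1 by (simp add: sum_subtractf)
  have T1: "0 \<le> T" "T \<le> 1"
  proof -
    show "0 \<le> T" unfolding T_def using tau0 by (intro sum_nonneg)
    show "T \<le> 1"
    proof (cases "out = 0")
      case True thus ?thesis by (simp add: T_def \<tau>_def)
    next
      case False
      hence "out * T \<le> out * 1" using outT ql by simp
      thus ?thesis using False out0 by simp
    qed
  qed
  have bound: "0 \<le> \<rho> z w \<and> \<rho> z w \<le> \<kappa>" for z w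
  proof (cases "z \<in> B")
    case True thus ?thesis using k by (auto simp: \<rho>_def)
  next
    case False
    define S where "S = (\<Sum>w'\<in>B. \<tau> w' * (if w' = w then 0 else \<kappa>))"
    have "0 \<le> S" unfolding S_def using tau0 k by (intro sum_nonneg) auto
    moreover have "S \<le> (\<Sum>w'\<in>B. \<tau> w' * \<kappa>)" unfolding S_def
      using tau0 k by (intro sum_mono mult_left_mono) auto
    hence "S \<le> T * \<kappa>" by (simp add: T_def sum_distrib_right)
    moreover have "(1 - T) * 1 \<le> (1 - T) * \<kappa>" using T1 k by (intro mult_left_mono) auto
    hence "1 - T \<le> \<kappa> - T * \<kappa>" by (simp add: algebra_simps)
    moreover have "\<rho> z w = (1 - T) + S" using False by (simp add: \<rho>_def S_def)
    ultimately show ?thesis using T1 by simp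
  qed
  have rowB: "(\<Sum>w\<in>B. if z = w then 0 else c) = c * (real q - 1)" if "z \<in> B" for z and c :: real
  proof -
    have "(\<Sum>w\<in>B. if z = w then 0 else c) = (\<Sum>w\<in>B. c - (if w = z then c else 0))"
      by (intro sum.cong) auto
    thus ?thesis using that finB assms(3) by (simp add: sum_subtractf algebra_simps)
  qed
  have rows: "(\<Sum>w\<in>B. \<rho> z w) = real q" for z
  proof (cases "z \<in> B")
    case True thus ?thesis using rowB[OF True, of \<kappa>] k by (simp add: \<rho>_def)
  next
    case False
    have "(\<Sum>w\<in>B. \<Sum>w'\<in>B. \<tau> w' * (if w' = w then 0 else \<kappa>)) =
       (\<Sum>w'\<in>B. \<tau> w' * (\<Sum>w\<in>B. if w' = w then 0 else \<kappa>))"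
      by (subst sum.swap) (simp add: sum_distrib_left)
    also have "\<dots> = (\<Sum>w'\<in>B. \<tau> w' * real q)" using rowB[of _ \<kappa>] k by (intro sum.cong) auto
    also have "\<dots> = T * real q" by (simp add: T_def sum_distrib_right)
    finally have "(\<Sum>w\<in>B. (1 - T) + (\<Sum>w'\<in>B. \<tau> w' * (if w' = w then 0 else \<kappa>))) = real q"
      unfolding sum.distrib by (simp add: assms(3) algebra_simps)
    thus ?thesis using False by (simp add: \<rho>_def)
  qed
  have columns: "(\<Sum>z\<in>X. \<nu> z * \<rho> z w) = 1" if w: "w \<in> B" for w
  proof -
    have *: "(\<Sum>w'\<in>B. f w' * (if w' = w then 0 else \<kappa>)) = \<kappa> * (sum f B - f w)" for f
    proof -
      have "(\<Sum>w'\<in>B. f w' * (if w' = w then 0 else \<kappa>)) = (\<Sum>w'\<in>B. \<kappa> * f w' - (if w' = w then \<kappa> * f w else 0))"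
        by (intro sum.cong) auto
      thus ?thesis using w finB by (simp add: sum_subtractf sum_distrib_left algebra_simps)
    qed
    have "(\<Sum>z\<in>X. \<nu> z * \<rho> z w) = (\<Sum>z\<in>B. \<nu> z * (if z = w then 0 else \<kappa>)) +
        out * ((1 - T) + \<kappa> * (T - \<tau> w))"
      by (simp add: split \<rho>_def * T_def[symmetric] out_def sum_distrib_right)
    also have "\<dots> = \<kappa> * (1 - out - \<nu> w) + out - out * T + \<kappa> * (out * T) - \<kappa> * (out * \<tau> w)"
      by (simp add: * B1 algebra_simps)
    also have "\<dots> = \<kappa> * (real q - 1) * l + 1 - real q * l"
      unfolding outT tau_mass[OF w] by (simp add: algebra_simps)
    also have "\<dots> = 1" using k(2) by simp
    finally show ?thesis .
  qed
  have xk: "xlnx \<kappa> = \<kappa> * ln \<kappa>" by (simp add: xlnx_def)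
  have xkq: "xlnx \<kappa> * (real q - 1) = real q * ln \<kappa>"
  proof -
    have "xlnx \<kappa> * (real q - 1) = (\<kappa> * (real q - 1)) * ln \<kappa>" by (simp add: xk)
    thus ?thesis by (simp only: k(2))
  qed
  have inB: "(\<Sum>w\<in>B. xlnx (\<rho> z w)) = real q * ln \<kappa>" if "z \<in> B" for z
  proof -
    have "(\<Sum>w\<in>B. xlnx (\<rho> z w)) = (\<Sum>w\<in>B. if z = w then 0 else xlnx \<kappa>)"
      using that by (intro sum.cong) (auto simp: \<rho>_def)
    thus ?thesis using rowB[OF that, of "xlnx \<kappa>"] xkq by simp
  qed
  have outB: "(\<Sum>w\<in>B. xlnx (\<rho> z w)) \<le> T * (real q * ln \<kappa>)" if "z \<notin> B" for z
  proof -
    have "xlnx (\<rho> z w) \<le> (\<Sum>w'\<in>B. \<tau> w' * (if w' = w then 0 else xlnx \<kappa>))" if "w \<in> B" for w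
    proof -
      let ?S = "insert None (Some ` B)"
      let ?p = "case_option (1 - T) \<tau>"
      let ?x = "case_option 1 (\<lambda>w'. if w' = w then 0 else \<kappa>)"
      have sS: "sum f ?S = f None + (\<Sum>w'\<in>B. f (Some w'))" for f :: "'a option \<Rightarrow> real"
        using finB by (simp add: sum.reindex)
      have "xlnx (\<Sum>s\<in>?S. ?p s * ?x s) \<le> (\<Sum>s\<in>?S. ?p s * xlnx (?x s))"
        using finB tau0 T1 k by (intro xlnx_jensen) (auto simp: sS T_def)
      hence "xlnx (\<rho> z w) \<le> (\<Sum>w'\<in>B. \<tau> w' * xlnx (if w' = w then 0 else \<kappa>))"
        using \<open>z \<notin> B\<close> by (simp add: sS \<rho>_def)
      also have "\<dots> = (\<Sum>w'\<in>B. \<tau> w' * (if w' = w then 0 else xlnx \<kappa>))"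
        by (intro sum.cong) auto
      finally show ?thesis .
    qed
    hence "(\<Sum>w\<in>B. xlnx (\<rho> z w)) \<le> (\<Sum>w\<in>B. \<Sum>w'\<in>B. \<tau> w' * (if w' = w then 0 else xlnx \<kappa>))"
      by (intro sum_mono)
    also have "\<dots> = (\<Sum>w'\<in>B. \<tau> w' * (\<Sum>w\<in>B. if w' = w then 0 else xlnx \<kappa>))"
      by (subst sum.swap) (simp add: sum_distrib_left)
    also have "\<dots> = (\<Sum>w'\<in>B. \<tau> w' * (real q * ln \<kappa>))"
      using rowB[of _ "xlnx \<kappa>"] xkq by (intro sum.cong) simp_all
    finally show ?thesis by (simp add: T_def sum_distrib_right)
  qed
  have "(\<Sum>w\<in>B. \<Sum>z\<in>X. \<nu> z * xlnx (\<rho> z w)) = (\<Sum>z\<in>X. \<nu> z * (\<Sum>w\<in>B. xlnx (\<rho> z w)))"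
    by (subst sum.swap) (simp add: sum_distrib_left)
  also have "\<dots> \<le> (\<Sum>z\<in>B. \<nu> z * (real q * ln \<kappa>)) + (\<Sum>z\<in>X-B. \<nu> z * (T * (real q * ln \<kappa>)))"
    unfolding split using inB outB nonneg assms(2) by (intro add_mono sum_mono mult_left_mono) auto
  also have "\<dots> = (1 - out + out * T) * (real q * ln \<kappa>)"
    unfolding sum_distrib_right[symmetric] B1 out_def[symmetric] by (simp add: algebra_simps)
  also have "\<dots> = real q * (real q * l * ln \<kappa>)" by (simp add: outT)
  finally show ?thesis using bound rows columns
    by (intro exI[of _ \<rho>]) (auto simp: \<rho>_def)
qed

text \<open>
  A law bounded by \<open>1/q\<close> is a mixture of uniform laws on sets of size \<open>q\<close>. The couplings with these
  uniform laws are mixed accordingly, and convexity of \<open>x ln x\<close> shows that mixing does not increase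
  the loss of entropy.
\<close>

lemma separating_density:
  fixes \<nu> \<mu> :: "'a \<Rightarrow> real"
  assumes X: "finite X" and q: "q \<ge> 2"
    and lam: "\<And>z. z \<in> X \<Longrightarrow> 0 \<le> \<nu> z" "\<And>z. z \<in> X \<Longrightarrow> \<nu> z \<le> l" "sum \<nu> X = 1"
    and mu: "\<And>w. w \<in> X \<Longrightarrow> 0 \<le> \<mu> w" "\<And>w. w \<in> X \<Longrightarrow> \<mu> w \<le> 1 / real q" "sum \<mu> X = 1"
    and ql: "real q * l \<le> 1"
  shows "\<exists>\<rho>. (\<forall>z\<in>X. \<forall>w\<in>X. 0 \<le> \<rho> z w \<and> \<rho> z w \<le> real q / real (q - 1)) \<and> (\<forall>w\<in>X. \<rho> w w = 0) \<and>
    (\<forall>w\<in>X. 0 < \<mu> w \<longrightarrow> (\<Sum>z\<in>X. \<nu> z * \<rho> z w) = 1) \<and> (\<forall>z\<in>X. (\<Sum>w\<in>X. \<mu> w * \<rho> z w) = 1) \<and>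
    (\<Sum>w\<in>X. \<mu> w * (\<Sum>z\<in>X. \<nu> z * xlnx (\<rho> z w))) \<le> real q * l * ln (real q / real (q - 1))"
proof -
  define \<kappa> where "\<kappa> = real q / real (q - 1)"
  let ?Q = "{B. B \<subseteq> X \<and> card B = q}"
  have finQ: "finite ?Q" using X by simp
  have q0: "real q > 0" using q by simp
  obtain c where c: "\<And>B. 0 \<le> c B" "sum c ?Q = 1"
      "\<And>w. w \<in> X \<Longrightarrow> real q * \<mu> w = (\<Sum>B\<in>?Q. if w \<in> B then c B else 0)"
  proof -
    have "0 \<le> real q * \<mu> w \<and> real q * \<mu> w \<le> 1" if "w \<in> X" for w
      using mu(1,2)[OF that] q0 by (simp add: field_simps)
    moreover have "(\<Sum>w\<in>X. real q * \<mu> w) = real q"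
      using mu(3) by (simp add: sum_distrib_left[symmetric])
    ultimately show ?thesis
      using convex_combination_of_sets[OF X, of "\<lambda>w. real q * \<mu> w" q] that by blast
  qed
  define sep where "sep B \<rho> \<longleftrightarrow> (\<forall>z\<in>X. \<forall>w\<in>B. 0 \<le> \<rho> z w \<and> \<rho> z w \<le> \<kappa>) \<and> (\<forall>w\<in>B. \<rho> w w = 0) \<and>
    (\<forall>w\<in>B. (\<Sum>z\<in>X. \<nu> z * \<rho> z w) = 1) \<and> (\<forall>z\<in>X. (\<Sum>w\<in>B. \<rho> z w) = real q) \<and>
    (\<Sum>w\<in>B. \<Sum>z\<in>X. \<nu> z * xlnx (\<rho> z w)) \<le> real q * (real q * l * ln \<kappa>)" for B \<rho>
  have "\<forall>B\<in>?Q. \<exists>\<rho>. sep B \<rho>"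
    unfolding sep_def \<kappa>_def using separate_from_uniform[OF X _ _ q lam ql] by auto
  then obtain r where "\<forall>B\<in>?Q. sep B (r B)" using bchoice by blast
  hence sep: "sep B (r B)" if "B \<in> ?Q" for B using that by blast
  have r: "\<And>B z w. B \<in> ?Q \<Longrightarrow> z \<in> X \<Longrightarrow> w \<in> B \<Longrightarrow> 0 \<le> r B z w \<and> r B z w \<le> \<kappa>"
      "\<And>B w. B \<in> ?Q \<Longrightarrow> w \<in> B \<Longrightarrow> r B w w = 0"
      "\<And>B w. B \<in> ?Q \<Longrightarrow> w \<in> B \<Longrightarrow> (\<Sum>z\<in>X. \<nu> z * r B z w) = 1"
      "\<And>B z. B \<in> ?Q \<Longrightarrow> z \<in> X \<Longrightarrow> (\<Sum>w\<in>B. r B z w) = real q"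
      "\<And>B. B \<in> ?Q \<Longrightarrow> (\<Sum>w\<in>B. \<Sum>z\<in>X. \<nu> z * xlnx (r B z w)) \<le> real q * (real q * l * ln \<kappa>)"
    using sep unfolding sep_def by blast+
  \<comment> \<open>The probability that the set is \<open>B\<close>, given that its random element is \<open>w\<close>.\<close>
  define p where "p w B = (if w \<in> B then c B / (real q * \<mu> w) else 0)" for w B
  have p0: "0 \<le> p w B" if "w \<in> X" for w B
    using c(1) mu(1)[OF that] by (simp add: p_def)
  have p1: "sum (p w) ?Q = 1" if "w \<in> X" "\<mu> w > 0" for w
  proof -
    have "sum (p w) ?Q = (\<Sum>B\<in>?Q. if w \<in> B then c B else 0) / (real q * \<mu> w)"
      unfolding p_def by (subst sum_divide_distrib) (intro sum.cong, auto)
    also have "\<dots> = (real q * \<mu> w) / (real q * \<mu> w)" by (simp only: c(3)[OF that(1)])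
    finally show ?thesis using that q0 by simp
  qed
  define \<rho> where "\<rho> z w = (\<Sum>B\<in>?Q. p w B * (if w \<in> B then r B z w else 0))" for z w
  have zero: "\<rho> z w = 0" if "w \<in> X" "\<mu> w = 0" for z w
    using that unfolding \<rho>_def p_def by (intro sum.neutral) auto
  have weight: "\<mu> w * p w B = (if w \<in> B then c B / real q else 0)" if "w \<in> X" "B \<in> ?Q" for w B
  proof (cases "\<mu> w = 0")
    case True
    have "(if w \<in> B then c B else 0) = 0"
      using c(3)[OF that(1)] True c(1) that(2) finQ
      by (simp add: sum_nonneg_eq_0_iff)
    thus ?thesis using True by (auto split: if_splits)
  qed (simp add: p_def)
  have average: "(\<Sum>w\<in>X. \<mu> w * (\<Sum>B\<in>?Q. p w B * f B w)) = (\<Sum>B\<in>?Q. c B / real q * (\<Sum>w\<in>B. f B w))" for f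
  proof -
    have "(\<Sum>w\<in>X. \<mu> w * (\<Sum>B\<in>?Q. p w B * f B w)) = (\<Sum>w\<in>X. \<Sum>B\<in>?Q. (\<mu> w * p w B) * f B w)"
      by (simp add: sum_distrib_left mult.assoc)
    also have "\<dots> = (\<Sum>w\<in>X. \<Sum>B\<in>?Q. (if w \<in> B then c B / real q * f B w else 0))"
      using weight by (intro sum.cong) auto
    also have "\<dots> = (\<Sum>B\<in>?Q. \<Sum>w\<in>X. (if w \<in> B then c B / real q * f B w else 0))"
      by (rule sum.swap)
    also have "\<dots> = (\<Sum>B\<in>?Q. \<Sum>w\<in>B. c B / real q * f B w)"
      using X by (intro sum.cong refl sum.mono_neutral_cong_right) auto
    finally show ?thesis by (simp add: sum_distrib_left)
  qed
  have k0: "\<kappa> \<ge> 0" by (simp add: \<kappa>_def)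
  have bound: "0 \<le> \<rho> z w \<and> \<rho> z w \<le> \<kappa>" if "z \<in> X" "w \<in> X" for z w
  proof (cases "\<mu> w = 0")
    case True thus ?thesis using zero that k0 by simp
  next
    case False
    have "\<rho> z w \<le> (\<Sum>B\<in>?Q. p w B * \<kappa>)" unfolding \<rho>_def
      using p0 r(1) that k0 by (intro sum_mono mult_left_mono) auto
    also have "\<dots> = \<kappa>" using p1[OF that(2)] False mu(1)[OF that(2)] by (simp add: sum_distrib_right[symmetric])
    finally show ?thesis unfolding \<rho>_def using p0 r(1) that by (auto intro!: sum_nonneg)
  qed
  have diag: "\<rho> w w = 0" for w unfolding \<rho>_def using r(2) by (intro sum.neutral) auto
  have columns: "(\<Sum>z\<in>X. \<nu> z * \<rho> z w) = 1" if "w \<in> X" "0 < \<mu> w" for w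
  proof -
    have "(\<Sum>z\<in>X. \<nu> z * \<rho> z w) = (\<Sum>B\<in>?Q. \<Sum>z\<in>X. \<nu> z * (p w B * (if w \<in> B then r B z w else 0)))"
      unfolding \<rho>_def sum_distrib_left by (rule sum.swap)
    also have "\<dots> = (\<Sum>B\<in>?Q. p w B * (if w \<in> B then (\<Sum>z\<in>X. \<nu> z * r B z w) else 0))"
      by (intro sum.cong) (auto simp: sum_distrib_left mult_ac)
    also have "\<dots> = sum (p w) ?Q" using r(3) by (intro sum.cong) (auto simp: p_def)
    finally show ?thesis using p1 that by simp
  qed
  have rows: "(\<Sum>w\<in>X. \<mu> w * \<rho> z w) = 1" if "z \<in> X" for z
  proof -
    have "(\<Sum>w\<in>X. \<mu> w * \<rho> z w) = (\<Sum>B\<in>?Q. c B / real q * (\<Sum>w\<in>B. if w \<in> B then r B z w else 0))"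
      unfolding \<rho>_def by (rule average)
    also have "\<dots> = sum c ?Q" using r(4) that q0 by (intro sum.cong) auto
    finally show ?thesis using c by simp
  qed
  have "(\<Sum>w\<in>X. \<mu> w * (\<Sum>z\<in>X. \<nu> z * xlnx (\<rho> z w))) \<le>
     (\<Sum>w\<in>X. \<mu> w * (\<Sum>B\<in>?Q. p w B * (\<Sum>z\<in>X. \<nu> z * xlnx (if w \<in> B then r B z w else 0))))"
  proof (intro sum_mono)
    fix w assume w: "w \<in> X"
    show "\<mu> w * (\<Sum>z\<in>X. \<nu> z * xlnx (\<rho> z w)) \<le>
      \<mu> w * (\<Sum>B\<in>?Q. p w B * (\<Sum>z\<in>X. \<nu> z * xlnx (if w \<in> B then r B z w else 0)))"
    proof (cases "\<mu> w = 0")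
      case False
      hence m: "\<mu> w > 0" using mu(1)[OF w] by simp
      have "(\<Sum>z\<in>X. \<nu> z * xlnx (\<rho> z w)) \<le> (\<Sum>z\<in>X. \<nu> z * (\<Sum>B\<in>?Q. p w B * xlnx (if w \<in> B then r B z w else 0)))"
        unfolding \<rho>_def using lam(1) p0[OF w] p1[OF w m] r(1) finQ
        by (intro sum_mono mult_left_mono xlnx_jensen) auto
      also have "\<dots> = (\<Sum>B\<in>?Q. p w B * (\<Sum>z\<in>X. \<nu> z * xlnx (if w \<in> B then r B z w else 0)))"
        unfolding sum_distrib_left by (subst sum.swap) (simp add: mult_ac)
      finally show ?thesis using m by (intro mult_left_mono) auto
    qed simp
  qed
  also have "\<dots> = (\<Sum>B\<in>?Q. c B / real q * (\<Sum>w\<in>B. \<Sum>z\<in>X. \<nu> z * xlnx (if w \<in> B then r B z w else 0)))"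
    by (rule average)
  also have "\<dots> = (\<Sum>B\<in>?Q. c B / real q * (\<Sum>w\<in>B. \<Sum>z\<in>X. \<nu> z * xlnx (r B z w)))"
    by (intro sum.cong) auto
  also have "\<dots> \<le> (\<Sum>B\<in>?Q. c B / real q * (real q * (real q * l * ln \<kappa>)))"
    using c(1) q0 r(5) by (intro sum_mono mult_left_mono) auto
  also have "\<dots> = (\<Sum>B\<in>?Q. c B * (real q * l * ln \<kappa>))" using q0 by (simp add: mult.assoc)
  also have "\<dots> = real q * l * ln \<kappa>" using c(2) by (simp add: sum_distrib_right[symmetric])
  finally show ?thesis using bound diag columns rows unfolding \<kappa>_def
    by (intro exI[of _ \<rho>]) blast
qed

definition separates :: "'a set \<Rightarrow> ('a \<Rightarrow> real) \<Rightarrow> ('a \<Rightarrow> real) \<Rightarrow> nat \<Rightarrow> real \<Rightarrow> ('a \<Rightarrow> 'a \<Rightarrow> real) \<Rightarrow> bool" where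
  "separates X \<nu> \<mu> q l \<rho> \<longleftrightarrow>
    (\<forall>z\<in>X. \<forall>w\<in>X. 0 \<le> \<rho> z w \<and> \<rho> z w \<le> real q / real (q - 1)) \<and> (\<forall>w\<in>X. \<rho> w w = 0) \<and>
    (\<forall>w\<in>X. 0 < \<mu> w \<longrightarrow> (\<Sum>z\<in>X. \<nu> z * \<rho> z w) = 1) \<and> (\<forall>z\<in>X. (\<Sum>w\<in>X. \<mu> w * \<rho> z w) = 1) \<and>
    (\<Sum>w\<in>X. \<mu> w * (\<Sum>z\<in>X. \<nu> z * xlnx (\<rho> z w))) \<le> real q * l * ln (real q / real (q - 1))"

text \<open>
  Choosing the density as a function of the two laws makes a law that is built from it depend only on
  what the two laws depend on.
\<close>

definition density :: "'a set \<Rightarrow> ('a \<Rightarrow> real) \<Rightarrow> ('a \<Rightarrow> real) \<Rightarrow> nat \<Rightarrow> real \<Rightarrow> 'a \<Rightarrow> 'a \<Rightarrow> real" where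
  "density X \<nu> \<mu> q l = (SOME \<rho>. separates X \<nu> \<mu> q l \<rho>)"

lemma separates_density: "\<exists>\<rho>. separates X \<nu> \<mu> q l \<rho> \<Longrightarrow> separates X \<nu> \<mu> q l (density X \<nu> \<mu> q l)"
  unfolding density_def by (rule someI_ex[where P = "separates X \<nu> \<mu> q l"])

section \<open>Adding a leaf to a random embedding\<close>

locale host =
  fixes V :: "'a set" and N :: "'a \<Rightarrow> 'a set" and t :: nat
  assumes finite_V: "finite V"
    and N_sub: "\<And>v. v \<in> V \<Longrightarrow> N v \<subseteq> V"
    and N_sym: "\<And>u v. u \<in> V \<Longrightarrow> v \<in> V \<Longrightarrow> u \<in> N v \<longleftrightarrow> v \<in> N u"
    and N_irrefl: "\<And>v. v \<notin> N v"
    and t_pos: "t \<ge> 1"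
    and min_degree: "\<And>v. v \<in> V \<Longrightarrow> t \<le> card (N v)"
begin

abbreviation deg :: "'a \<Rightarrow> nat" where "deg v \<equiv> card (N v)"

text \<open>
  The bounds for step \<open>n\<close> of attaching a leaf to a vertex at \<open>v\<close>, in which the law of the leaf is
  conditioned on a subtree with \<open>n\<close> edges. The next vertex to be avoided has conditional probabilities of
  at most \<open>1 / q n v\<close>, the leaf has conditional probabilities of at most \<open>cap n v\<close>, and avoiding
  that vertex loses entropy at most \<open>cost n v\<close>. For \<open>n = 0\<close> both vertices are uniform on the neighbours of
  \<open>v\<close>.
\<close>

definition q :: "nat \<Rightarrow> 'a \<Rightarrow> nat" where "q n v = (if n = 0 then deg v else t - n)"

definition cap :: "nat \<Rightarrow> 'a \<Rightarrow> real" where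
  "cap n v = (if n = 0 then 1 / real (deg v) else real (t - 1) / (real (deg v - 1) * real (t - n)))"

definition cost :: "nat \<Rightarrow> 'a \<Rightarrow> real" where
  "cost n v = real (q n v) * cap n v * ln (real (q n v) / real (q n v - 1))"

text \<open>
  If \<open>P\<close> is the law of a random map on \<open>I\<close>, then \<open>marg I P A \<alpha>\<close> is the probability that this map
  agrees with \<open>\<alpha>\<close> on \<open>A\<close>. Describing conditions on a set \<open>A\<close> by maps that are defined everywhere
  allows \<open>A\<close> to vary freely.
\<close>

definition agree :: "nat set \<Rightarrow> nat set \<Rightarrow> (nat \<Rightarrow> 'a) \<Rightarrow> (nat \<Rightarrow> 'a) set" where
  "agree I A \<alpha> = {\<phi> \<in> I \<rightarrow>\<^sub>E V. \<forall>k\<in>A. \<phi> k = \<alpha> k}"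

definition marg :: "nat set \<Rightarrow> ((nat \<Rightarrow> 'a) \<Rightarrow> real) \<Rightarrow> nat set \<Rightarrow> (nat \<Rightarrow> 'a) \<Rightarrow> real" where
  "marg I P A \<alpha> = sum P (agree I A \<alpha>)"

lemma finite_agree: "finite I \<Longrightarrow> finite (agree I A \<alpha>)"
  unfolding agree_def using finite_V by (auto intro!: finite_PiE)

lemma agree_cong: "(\<And>k. k \<in> A \<Longrightarrow> \<alpha> k = \<beta> k) \<Longrightarrow> agree I A \<alpha> = agree I A \<beta>"
  unfolding agree_def by auto

lemma marg_cong: "(\<And>k. k \<in> A \<Longrightarrow> \<alpha> k = \<beta> k) \<Longrightarrow> marg I P A \<alpha> = marg I P A \<beta>"
  unfolding marg_def by (rule arg_cong[where f = "sum P"], rule agree_cong)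

lemma marg_alt: "finite J \<Longrightarrow> marg J Q B \<alpha> = (\<Sum>\<phi>\<in>J \<rightarrow>\<^sub>E V. if \<forall>k\<in>B. \<phi> k = \<alpha> k then Q \<phi> else 0)"
  unfolding marg_def agree_def using finite_V
  by (subst sum.inter_filter[symmetric]) (auto intro!: finite_PiE)

lemma sum_agree_split:
  assumes "finite I" "y \<in> I" "y \<notin> A"
  shows "sum g (agree I A \<alpha>) = (\<Sum>w\<in>V. sum g (agree I (insert y A) (\<alpha>(y := w))))"
proof -
  have "(\<lambda>\<phi>. \<phi> y) ` agree I A \<alpha> \<subseteq> V" using assms(2) unfolding agree_def by (auto dest: PiE_mem)
  from sum.group[OF finite_agree[OF assms(1)] finite_V this, of g]
  have "sum g (agree I A \<alpha>) = (\<Sum>w\<in>V. sum g {\<phi> \<in> agree I A \<alpha>. \<phi> y = w})" by simp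
  moreover have "{\<phi> \<in> agree I A \<alpha>. \<phi> y = w} = agree I (insert y A) (\<alpha>(y := w))" for w
    using assms(3) unfolding agree_def by auto
  ultimately show ?thesis by simp
qed

lemma sum_PiE_insert:
  assumes "l \<notin> I"
  shows "(\<Sum>\<phi>\<in>insert l I \<rightarrow>\<^sub>E V. g \<phi>) = (\<Sum>\<phi>\<in>I \<rightarrow>\<^sub>E V. \<Sum>z\<in>V. g (\<phi>(l := z)))"
proof -
  have "(\<Sum>\<phi>\<in>insert l I \<rightarrow>\<^sub>E V. g \<phi>) = (\<Sum>(z, \<phi>)\<in>V \<times> (I \<rightarrow>\<^sub>E V). g (\<phi>(l := z)))"
    unfolding PiE_insert_eq
    by (subst sum.reindex[OF inj_combinator[OF assms]]) (auto intro!: sum.cong)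
  also have "\<dots> = (\<Sum>z\<in>V. \<Sum>\<phi>\<in>I \<rightarrow>\<^sub>E V. g (\<phi>(l := z)))" by (simp add: sum.cartesian_product)
  also have "\<dots> = (\<Sum>\<phi>\<in>I \<rightarrow>\<^sub>E V. \<Sum>z\<in>V. g (\<phi>(l := z)))" by (rule sum.swap)
  finally show ?thesis .
qed

end

text \<open>
  A leaf is to be attached to the vertex \<open>c 0\<close> of a tree with vertex set \<open>I\<close> that is embedded at random
  with law \<open>P\<close>. The vertices are avoided in the order \<open>c 1, c 2, \<dots>\<close>, and the bounds limit the
  conditional law of each of them given its predecessors.
\<close>

locale extension = host +
  fixes I :: "nat set" and P :: "(nat \<Rightarrow> 'a) \<Rightarrow> real" and c :: "nat \<Rightarrow> nat" and m :: nat
  assumes m: "1 \<le> m" "m \<le> t"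
    and c_inj: "inj_on c {..<m}" and c_image: "c ` {..<m} = I"
    and P_nonneg: "\<And>\<phi>. 0 \<le> P \<phi>"
    and P_one: "sum P (I \<rightarrow>\<^sub>E V) = 1"
    and bound_first: "\<And>\<alpha>. 2 \<le> m \<Longrightarrow> marg I P (c ` {..1}) \<alpha> \<le> marg I P (c ` {..0}) \<alpha> / real (card (N (\<alpha> (c 0))))"
    and bound: "\<And>n \<alpha>. 1 \<le> n \<Longrightarrow> Suc n < m \<Longrightarrow>
       marg I P (c ` {..Suc n}) \<alpha> \<le> marg I P (c ` {..n}) \<alpha> / real (t - n)"
begin

definition A :: "nat \<Rightarrow> nat set" where "A n = c ` {..n}"

abbreviation M where "M \<equiv> marg I P"

text \<open>
  The law of the position of \<open>c (Suc n)\<close> given that \<open>c 0, \<dots>, c n\<close> are placed according to \<open>\<alpha>\<close>. It is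
  meaningful only if this condition has positive probability.
\<close>

definition cond :: "nat \<Rightarrow> (nat \<Rightarrow> 'a) \<Rightarrow> 'a \<Rightarrow> real" where
  "cond n \<alpha> w = M (A (Suc n)) (\<alpha>(c (Suc n) := w)) / M (A n) \<alpha>"

text \<open>
  The law of the leaf given the positions of \<open>c 0, \<dots>, c n\<close>. A joint density relative to independence
  becomes a conditional law when it is multiplied by the law of the leaf.
\<close>

primrec kernel :: "nat \<Rightarrow> (nat \<Rightarrow> 'a) \<Rightarrow> 'a \<Rightarrow> real" where
  "kernel 0 \<alpha> = (\<lambda>z. if z \<in> N (\<alpha> (c 0)) then 1 / real (deg (\<alpha> (c 0))) else 0)"
| "kernel (Suc n) \<alpha> = (\<lambda>z. kernel n \<alpha> z *
     density V (kernel n \<alpha>) (cond n \<alpha>) (q n (\<alpha> (c 0))) (cap n (\<alpha> (c 0))) z (\<alpha> (c (Suc n))))"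

abbreviation \<rho> where
  "\<rho> n \<alpha> \<equiv> density V (kernel n \<alpha>) (cond n \<alpha>) (q n (\<alpha> (c 0))) (cap n (\<alpha> (c 0)))"

lemma finite_I: "finite I" unfolding c_image[symmetric] by simp

lemma A_Suc: "A (Suc n) = insert (c (Suc n)) (A n)" unfolding A_def by (simp add: atMost_Suc)

lemma A_last: "A (m - 1) = I"
proof -
  have "{..m - 1} = {..<m}" using m(1) by auto
  thus ?thesis unfolding A_def using c_image by simp
qed

lemma c0_in_A: "c 0 \<in> A n" unfolding A_def by auto

lemma next_in_I: "Suc n < m \<Longrightarrow> c (Suc n) \<in> I" using c_image by auto

lemma next_notin_A: "Suc n < m \<Longrightarrow> c (Suc n) \<notin> A n"
proof
  assume "Suc n < m" "c (Suc n) \<in> A n"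
  then obtain k where "k \<le> n" "c k = c (Suc n)" unfolding A_def by auto
  with inj_onD[OF c_inj, of k "Suc n"] \<open>Suc n < m\<close> show False by simp
qed

lemma next_neq_c0: "Suc n < m \<Longrightarrow> c (Suc n) \<noteq> c 0"
  using next_notin_A[of n] c0_in_A[of n] by auto

lemma A_sub: "n < m \<Longrightarrow> A n \<subseteq> I" using c_image unfolding A_def by auto

lemma marg_nonneg: "0 \<le> M B \<alpha>" unfolding marg_def using P_nonneg by (intro sum_nonneg) auto

lemma marg_split: "Suc n < m \<Longrightarrow> M (A n) \<alpha> = (\<Sum>w\<in>V. M (A (Suc n)) (\<alpha>(c (Suc n) := w)))"
  unfolding marg_def A_Suc by (rule sum_agree_split[OF finite_I next_in_I next_notin_A])

lemma marg_mono: "B \<subseteq> C \<Longrightarrow> M C \<alpha> \<le> M B \<alpha>"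
  unfolding marg_def using finite_agree[OF finite_I] P_nonneg
  by (intro sum_mono2) (auto simp: agree_def)

lemma marg_pos_in_V: "0 < M B \<alpha> \<Longrightarrow> B \<subseteq> I \<Longrightarrow> k \<in> B \<Longrightarrow> \<alpha> k \<in> V"
proof -
  assume "0 < M B \<alpha>" and B: "B \<subseteq> I" "k \<in> B"
  hence "agree I B \<alpha> \<noteq> {}" unfolding marg_def by auto
  then obtain \<phi> where "\<phi> \<in> I \<rightarrow>\<^sub>E V" "\<forall>k\<in>B. \<phi> k = \<alpha> k" unfolding agree_def by blast
  moreover have "k \<in> I" using B by blast
  ultimately show ?thesis using PiE_mem[of \<phi> I "\<lambda>_. V" k] B(2) by simp
qed

lemma bound_q: "Suc n < m \<Longrightarrow> M (A (Suc n)) \<alpha> \<le> M (A n) \<alpha> / real (q n (\<alpha> (c 0)))"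
  using bound_first[of \<alpha>] bound[of n \<alpha>] unfolding q_def A_def by (cases n) auto

lemma q_ge_2: "Suc n < m \<Longrightarrow> v \<in> V \<Longrightarrow> 2 \<le> q n v"
  using m min_degree[of v] unfolding q_def by auto

lemma q_cap_le_1: "Suc n < m \<Longrightarrow> v \<in> V \<Longrightarrow> real (q n v) * cap n v \<le> 1"
proof (cases "n = 0")
  case False
  assume *: "Suc n < m" "v \<in> V"
  hence "real (t - 1) \<le> real (deg v) - 1" "0 < real (t - n)" "0 < real (deg v) - 1"
    using m min_degree[of v] by linarith+
  thus ?thesis using False by (simp add: q_def cap_def)
qed (simp add: q_def cap_def)

text \<open>
  Avoiding one vertex increases the largest probability of the leaf by at most the factor
  \<open>q / (q - 1)\<close>, so the bounds telescope.
\<close>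

lemma cap_Suc:
  assumes "Suc n < m" "v \<in> V"
  shows "real (q n v) / real (q n v - 1) * cap n v = cap (Suc n) v"
proof (cases "n = 0")
  case True thus ?thesis using assms m min_degree[of v] by (simp add: q_def cap_def)
next
  case False
  have "t - Suc n = t - n - 1" by simp
  thus ?thesis using assms False m min_degree[of v] by (simp add: q_def cap_def)
qed

lemma kernel_cong: "n < m \<Longrightarrow> (\<And>k. k \<in> A n \<Longrightarrow> \<alpha> k = \<beta> k) \<Longrightarrow> kernel n \<alpha> = kernel n \<beta>"
proof (induction n)
  case 0 
  have "\<alpha> (c 0) = \<beta> (c 0)" by (rule 0(2)) (rule c0_in_A)
  thus ?case by (simp only: kernel.simps)
next
  case (Suc n)
  have e: "\<alpha> k = \<beta> k" if "k \<in> A n" for k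
    by (rule Suc.prems(2)) (simp add: A_Suc that)
  have 1: "cond n \<alpha> = cond n \<beta>"
  proof
    fix w
    have "M (A (Suc n)) (\<alpha>(c (Suc n) := w)) = M (A (Suc n)) (\<beta>(c (Suc n) := w))"
      by (rule marg_cong) (auto simp: A_Suc e)
    moreover have "M (A n) \<alpha> = M (A n) \<beta>" by (rule marg_cong) (rule e)
    ultimately show "cond n \<alpha> w = cond n \<beta> w" by (simp add: cond_def)
  qed
  have 2: "kernel n \<alpha> = kernel n \<beta>" by (rule Suc.IH[OF Suc_lessD[OF Suc.prems(1)] e])
  have 3: "\<alpha> (c 0) = \<beta> (c 0)" "\<alpha> (c (Suc n)) = \<beta> (c (Suc n))"
    by (rule Suc.prems(2), simp add: A_Suc c0_in_A)+
  show ?case by (simp only: kernel.simps 1 2 3)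
qed

lemma kernel_upd:
  assumes "Suc n < m"
  shows "kernel (Suc n) (\<alpha>(c (Suc n) := w)) = (\<lambda>z. kernel n \<alpha> z * \<rho> n \<alpha> z w)"
proof -
  let ?a = "\<alpha>(c (Suc n) := w)"
  have 1: "kernel n ?a = kernel n \<alpha>"
    using assms next_notin_A by (intro kernel_cong) auto
  have "M (A n) (\<alpha>(c (Suc n) := w)) = M (A n) \<alpha>"
    using assms next_notin_A by (intro marg_cong) auto
  hence 2: "cond n ?a = cond n \<alpha>" by (intro ext) (simp add: cond_def)
  have 3: "?a (c 0) = \<alpha> (c 0)" "?a (c (Suc n)) = w" using next_neq_c0[OF assms] by simp_all
  show ?thesis by (simp only: kernel.simps 1 2 3)
qed

definition proper :: "nat \<Rightarrow> (nat \<Rightarrow> 'a) \<Rightarrow> bool" where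
  "proper n \<alpha> \<longleftrightarrow> (\<forall>z\<in>V. 0 \<le> kernel n \<alpha> z \<and> kernel n \<alpha> z \<le> cap n (\<alpha> (c 0))) \<and> sum (kernel n \<alpha>) V = 1 \<and>
     (\<forall>z\<in>V. kernel n \<alpha> z \<noteq> 0 \<longrightarrow> z \<in> N (\<alpha> (c 0)) \<and> z \<notin> \<alpha> ` A n)"

lemma separates_proper:
  assumes "Suc n < m" "0 < M (A n) \<alpha>" "proper n \<alpha>"
  shows "separates V (kernel n \<alpha>) (cond n \<alpha>) (q n (\<alpha> (c 0))) (cap n (\<alpha> (c 0))) (\<rho> n \<alpha>)"
proof (rule separates_density)
  have v: "\<alpha> (c 0) \<in> V" using marg_pos_in_V[OF assms(2) A_sub c0_in_A] assms(1) by simp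
  have "M (A (Suc n)) (\<alpha>(c (Suc n) := w)) \<le> M (A n) \<alpha> / real (q n (\<alpha> (c 0)))" for w
  proof -
    have "M (A n) (\<alpha>(c (Suc n) := w)) = M (A n) \<alpha>"
      using assms next_notin_A by (intro marg_cong) auto
    thus ?thesis using bound_q[OF assms(1), of "\<alpha>(c (Suc n) := w)"] next_neq_c0[OF assms(1)] by simp
  qed
  hence "cond n \<alpha> w \<le> 1 / real (q n (\<alpha> (c 0)))" for w
    using assms(2) q_ge_2[OF assms(1) v] unfolding cond_def by (simp add: field_simps)
  moreover have "0 \<le> cond n \<alpha> w" for w unfolding cond_def by (simp add: marg_nonneg)
  moreover have "sum (cond n \<alpha>) V = 1"
    unfolding cond_def using marg_split[OF assms(1), of \<alpha>] assms(2)
    by (simp add: sum_divide_distrib[symmetric])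
  ultimately show "\<exists>\<rho>. separates V (kernel n \<alpha>) (cond n \<alpha>) (q n (\<alpha> (c 0))) (cap n (\<alpha> (c 0))) \<rho>"
    using assms(3) q_ge_2[OF assms(1) v] q_cap_le_1[OF assms(1) v] unfolding separates_def proper_def
    by (intro separating_density[OF finite_V]) auto
qed

text \<open>
  The vanishing diagonal of the density excludes a collision of the leaf with \<open>c (Suc n)\<close>. Collisions
  with earlier vertices are already impossible under the kernel that is modified.
\<close>

lemma proper: "n < m \<Longrightarrow> 0 < M (A n) \<alpha> \<Longrightarrow> proper n \<alpha>"
proof (induction n arbitrary: \<alpha>)
  case 0
  have v: "\<alpha> (c 0) \<in> V" using marg_pos_in_V[OF 0(2) A_sub c0_in_A] 0 by simp
  have d: "0 < deg (\<alpha> (c 0))" using min_degree[OF v] t_pos by simp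
  have "(\<Sum>z\<in>V. kernel 0 \<alpha> z) = (\<Sum>z\<in>N (\<alpha> (c 0)). 1 / real (deg (\<alpha> (c 0))))"
    using finite_V N_sub[OF v] by (intro sum.mono_neutral_cong_right) auto
  thus ?case using d N_irrefl unfolding proper_def by (auto simp: cap_def A_def)
next
  case (Suc n)
  let ?w = "\<alpha> (c (Suc n))"
  have M0: "0 < M (A n) \<alpha>" using Suc.prems(2) marg_mono[of "A n" "A (Suc n)" \<alpha>] A_Suc[of n]
    by (metis order_less_le_trans subset_insertI)
  have g: "proper n \<alpha>" using Suc M0 by simp
  note sep = separates_proper[OF Suc.prems(1) M0 g, unfolded separates_def]
  have v: "\<alpha> (c 0) \<in> V" using marg_pos_in_V[OF M0 A_sub c0_in_A] Suc.prems by simp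
  have w: "?w \<in> V" using marg_pos_in_V[OF Suc.prems(2) A_sub] Suc.prems A_Suc by auto
  have "0 < cond n \<alpha> ?w" using Suc.prems(2) M0 by (simp add: cond_def)
  hence "sum (kernel (Suc n) \<alpha>) V = 1" using sep w by simp
  moreover have "0 \<le> kernel (Suc n) \<alpha> z \<and> kernel (Suc n) \<alpha> z \<le> cap (Suc n) (\<alpha> (c 0))" if z: "z \<in> V" for z
  proof -
    have r: "0 \<le> \<rho> n \<alpha> z ?w" "\<rho> n \<alpha> z ?w \<le> real (q n (\<alpha> (c 0))) / real (q n (\<alpha> (c 0)) - 1)"
      using sep z w by blast+
    have k: "0 \<le> kernel n \<alpha> z" "kernel n \<alpha> z \<le> cap n (\<alpha> (c 0))" using g z unfolding proper_def by blast+
    have "kernel (Suc n) \<alpha> z \<le> cap n (\<alpha> (c 0)) * (real (q n (\<alpha> (c 0))) / real (q n (\<alpha> (c 0)) - 1))"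
      using r k by (simp only: kernel.simps) (intro mult_mono, auto)
    thus ?thesis using r k cap_Suc[OF Suc.prems(1) v] by (simp add: mult.commute)
  qed
  moreover have "z \<in> N (\<alpha> (c 0)) \<and> z \<notin> \<alpha> ` A (Suc n)" if z: "z \<in> V" "kernel (Suc n) \<alpha> z \<noteq> 0" for z
  proof -
    have "kernel n \<alpha> z \<noteq> 0" "z \<noteq> ?w" using z sep by auto
    thus ?thesis using g z(1) unfolding proper_def A_Suc by auto
  qed
  ultimately show ?case unfolding proper_def by blast
qed

text \<open>
  Forgetting the position of \<open>c (Suc n)\<close> gives back the previous kernel, because a coupling preserves
  the law of the leaf.
\<close>

lemma kernel_average:
  assumes "Suc n < m" "z \<in> V"
  shows "(\<Sum>w\<in>V. M (A (Suc n)) (\<alpha>(c (Suc n) := w)) * kernel (Suc n) (\<alpha>(c (Suc n) := w)) z) = M (A n) \<alpha> * kernel n \<alpha> z"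
proof (cases "M (A n) \<alpha> = 0")
  case True
  hence "M (A (Suc n)) (\<alpha>(c (Suc n) := w)) = 0" if "w \<in> V" for w
    using marg_split[OF assms(1), of \<alpha>] that finite_V by (simp add: sum_nonneg_eq_0_iff marg_nonneg)
  thus ?thesis using True by simp
next
  case False
  hence M0: "0 < M (A n) \<alpha>" using marg_nonneg[of "A n" \<alpha>] by simp
  note sep = separates_proper[OF assms(1) M0 proper[OF Suc_lessD[OF assms(1)] M0], unfolded separates_def]
  have "(\<Sum>w\<in>V. M (A (Suc n)) (\<alpha>(c (Suc n) := w)) * kernel (Suc n) (\<alpha>(c (Suc n) := w)) z)
    = M (A n) \<alpha> * kernel n \<alpha> z * (\<Sum>w\<in>V. cond n \<alpha> w * \<rho> n \<alpha> z w)"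
    unfolding kernel_upd[OF assms(1)] sum_distrib_left
  proof (intro sum.cong refl)
    fix w
    have "M (A (Suc n)) (\<alpha>(c (Suc n) := w)) = M (A n) \<alpha> * cond n \<alpha> w"
      using False by (simp add: cond_def)
    thus "M (A (Suc n)) (\<alpha>(c (Suc n) := w)) * (kernel n \<alpha> z * \<rho> n \<alpha> z w) =
       M (A n) \<alpha> * kernel n \<alpha> z * (cond n \<alpha> w * \<rho> n \<alpha> z w)" by (simp only: mult_ac)
  qed
  moreover have "(\<Sum>w\<in>V. cond n \<alpha> w * \<rho> n \<alpha> z w) = 1" using sep assms(2) by blast
  ultimately show ?thesis by (simp only: mult_1_right)
qed

text \<open>
  The bound on the density also limits how much the knowledge of the leaf can increase the probability
  of a position of \<open>c (Suc n)\<close>. The right-hand side is the joint probability of the leaf and the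
  positions of \<open>c 0, \<dots>, c n\<close>, divided by \<open>t - (n + 1)\<close>.
\<close>

lemma kernel_mass_bound:
  assumes "Suc n < m" "z \<in> V"
  shows "M (A (Suc n)) \<alpha> * kernel (Suc n) \<alpha> z \<le> M (A n) \<alpha> * kernel n \<alpha> z / real (t - Suc n)"
proof (cases "M (A (Suc n)) \<alpha> = 0")
  case True
  moreover have "0 \<le> M (A n) \<alpha> * kernel n \<alpha> z"
  proof (cases "M (A n) \<alpha> = 0")
    case False
    hence "0 < M (A n) \<alpha>" using marg_nonneg[of "A n" \<alpha>] by simp
    hence "proper n \<alpha>" using proper[of n \<alpha>] assms(1) by simp
    thus ?thesis using assms(2) marg_nonneg unfolding proper_def by auto
  qed simp
  ultimately show ?thesis by simp
next
  case False
  hence M1: "0 < M (A (Suc n)) \<alpha>" using marg_nonneg[of "A (Suc n)" \<alpha>] by simp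
  hence M0: "0 < M (A n) \<alpha>" using marg_mono[of "A n" "A (Suc n)" \<alpha>] A_Suc[of n]
    by (metis order_less_le_trans subset_insertI)
  have g: "proper n \<alpha>" using proper assms M0 by simp
  note sep = separates_proper[OF assms(1) M0 g, unfolded separates_def]
  have v: "\<alpha> (c 0) \<in> V" using marg_pos_in_V[OF M0 A_sub c0_in_A] assms by simp
  have w: "\<alpha> (c (Suc n)) \<in> V" using marg_pos_in_V[OF M1 A_sub] assms A_Suc by auto
  let ?q = "q n (\<alpha> (c 0))"
  have q2: "2 \<le> ?q" using q_ge_2[OF assms(1) v] .
  have k: "0 \<le> kernel n \<alpha> z" using g assms(2) unfolding proper_def by blast
  have r: "0 \<le> \<rho> n \<alpha> z (\<alpha> (c (Suc n)))" "\<rho> n \<alpha> z (\<alpha> (c (Suc n))) \<le> real ?q / real (?q - 1)"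
    using sep assms(2) w by blast+
  have "M (A (Suc n)) \<alpha> * kernel (Suc n) \<alpha> z \<le> (M (A n) \<alpha> / real ?q) * (kernel n \<alpha> z * (real ?q / real (?q - 1)))"
    using bound_q[OF assms(1), of \<alpha>] k r M1 by (simp only: kernel.simps) (intro mult_mono, auto)
  also have "\<dots> = M (A n) \<alpha> * kernel n \<alpha> z / real (?q - 1)" using q2 by (simp add: field_simps)
  also have "\<dots> \<le> M (A n) \<alpha> * kernel n \<alpha> z / real (t - Suc n)"
    using k M0 min_degree[OF v] m assms(1) by (intro divide_left_mono) (auto simp: q_def)
  finally show ?thesis .
qed

abbreviation final where "final \<equiv> kernel (m - 1)"

text \<open>
  By iterated averaging, each intermediate kernel is the conditional law of the final leaf.
\<close>

lemma final_marg:
  assumes "n < m" "z \<in> V"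
  shows "(\<Sum>\<phi>\<in>agree I (A n) \<alpha>. P \<phi> * final \<phi> z) = M (A n) \<alpha> * kernel n \<alpha> z"
proof -
  have "n \<le> m - 1" using assms(1) by simp
  thus ?thesis
  proof (induction arbitrary: \<alpha> rule: inc_induct)
    case base
    have const: "final \<phi> = final \<alpha>" if "\<phi> \<in> agree I (A (m - 1)) \<alpha>" for \<phi>
      using that m(1) by (intro kernel_cong) (auto simp: agree_def)
    have "(\<Sum>\<phi>\<in>agree I (A (m - 1)) \<alpha>. P \<phi> * G (final \<phi>)) = M (A (m - 1)) \<alpha> * G (final \<alpha>)" for G
      unfolding marg_def sum_distrib_right by (intro sum.cong refl arg_cong2[where f = "(*)"] arg_cong[where f = G] const)
    from this[of "\<lambda>f. f z"] show ?case by simp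
  next
    case (step k)
    hence k: "Suc k < m" by simp
    show ?case
      unfolding sum_agree_split[OF finite_I next_in_I[OF k] next_notin_A[OF k]] A_Suc[symmetric] step.IH
      by (rule kernel_average[OF k assms(2)])
  qed
qed

text \<open>
  The function \<open>x ln x\<close> turns the product of kernel and density into a sum. The first summand averages to the
  old negative entropy, and the second one is the relative entropy of the coupling.
\<close>

lemma kernel_entropy_step:
  assumes "Suc n < m"
  shows "(\<Sum>w\<in>V. M (A (Suc n)) (\<alpha>(c (Suc n) := w)) * (\<Sum>z\<in>V. xlnx (kernel (Suc n) (\<alpha>(c (Suc n) := w)) z)))
    \<le> M (A n) \<alpha> * ((\<Sum>z\<in>V. xlnx (kernel n \<alpha> z)) + cost n (\<alpha> (c 0)))"
proof (cases "M (A n) \<alpha> = 0")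
  case True
  hence "M (A (Suc n)) (\<alpha>(c (Suc n) := w)) = 0" if "w \<in> V" for w
    using marg_split[OF assms(1), of \<alpha>] that finite_V by (simp add: sum_nonneg_eq_0_iff marg_nonneg)
  thus ?thesis using True by simp
next
  case False
  hence M0: "0 < M (A n) \<alpha>" using marg_nonneg[of "A n" \<alpha>] by simp
  have g: "proper n \<alpha>" using proper assms M0 by simp
  note sep = separates_proper[OF assms(1) M0 g, unfolded separates_def]
  have rows: "(\<Sum>w\<in>V. cond n \<alpha> w * \<rho> n \<alpha> z w) = 1" if "z \<in> V" for z using sep that by blast
  have ent: "(\<Sum>w\<in>V. cond n \<alpha> w * (\<Sum>z\<in>V. kernel n \<alpha> z * xlnx (\<rho> n \<alpha> z w))) \<le> cost n (\<alpha> (c 0))"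
    using sep unfolding cost_def by blast
  have "(\<Sum>w\<in>V. M (A (Suc n)) (\<alpha>(c (Suc n) := w)) * (\<Sum>z\<in>V. xlnx (kernel (Suc n) (\<alpha>(c (Suc n) := w)) z)))
    = M (A n) \<alpha> * (\<Sum>w\<in>V. cond n \<alpha> w * (\<Sum>z\<in>V. xlnx (kernel n \<alpha> z * \<rho> n \<alpha> z w)))"
    unfolding kernel_upd[OF assms] sum_distrib_left[of "M (A n) \<alpha>"]
  proof (intro sum.cong refl)
    fix w
    have "M (A (Suc n)) (\<alpha>(c (Suc n) := w)) = M (A n) \<alpha> * cond n \<alpha> w"
      using False by (simp add: cond_def)
    thus "M (A (Suc n)) (\<alpha>(c (Suc n) := w)) * (\<Sum>z\<in>V. xlnx (kernel n \<alpha> z * \<rho> n \<alpha> z w)) =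
       M (A n) \<alpha> * (cond n \<alpha> w * (\<Sum>z\<in>V. xlnx (kernel n \<alpha> z * \<rho> n \<alpha> z w)))" by (simp only: mult.assoc)
  qed
  also have "(\<Sum>w\<in>V. cond n \<alpha> w * (\<Sum>z\<in>V. xlnx (kernel n \<alpha> z * \<rho> n \<alpha> z w))) =
    (\<Sum>w\<in>V. \<Sum>z\<in>V. xlnx (kernel n \<alpha> z) * (cond n \<alpha> w * \<rho> n \<alpha> z w) + cond n \<alpha> w * (kernel n \<alpha> z * xlnx (\<rho> n \<alpha> z w)))"
    unfolding sum_distrib_left
  proof (intro sum.cong refl)
    fix w z assume "w \<in> V" "z \<in> V"
    hence "0 \<le> kernel n \<alpha> z" "0 \<le> \<rho> n \<alpha> z w" using g sep unfolding proper_def by blast+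
    thus "cond n \<alpha> w * xlnx (kernel n \<alpha> z * \<rho> n \<alpha> z w) =
       xlnx (kernel n \<alpha> z) * (cond n \<alpha> w * \<rho> n \<alpha> z w) + cond n \<alpha> w * (kernel n \<alpha> z * xlnx (\<rho> n \<alpha> z w))"
      by (simp only: xlnx_mult distrib_left mult_ac)
  qed
  also have "\<dots> = (\<Sum>z\<in>V. xlnx (kernel n \<alpha> z) * (\<Sum>w\<in>V. cond n \<alpha> w * \<rho> n \<alpha> z w)) +
     (\<Sum>w\<in>V. cond n \<alpha> w * (\<Sum>z\<in>V. kernel n \<alpha> z * xlnx (\<rho> n \<alpha> z w)))"
    unfolding sum.distrib sum_distrib_left by (rule arg_cong2[where f = "(+)", OF sum.swap refl])
  also have "(\<Sum>z\<in>V. xlnx (kernel n \<alpha> z) * (\<Sum>w\<in>V. cond n \<alpha> w * \<rho> n \<alpha> z w)) = (\<Sum>z\<in>V. xlnx (kernel n \<alpha> z))"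
    by (intro sum.cong refl) (simp only: rows mult_1_right)
  finally have eq: "(\<Sum>w\<in>V. M (A (Suc n)) (\<alpha>(c (Suc n) := w)) * (\<Sum>z\<in>V. xlnx (kernel (Suc n) (\<alpha>(c (Suc n) := w)) z)))
    = M (A n) \<alpha> * ((\<Sum>z\<in>V. xlnx (kernel n \<alpha> z)) +
       (\<Sum>w\<in>V. cond n \<alpha> w * (\<Sum>z\<in>V. kernel n \<alpha> z * xlnx (\<rho> n \<alpha> z w))))" .
  show ?thesis unfolding eq by (intro mult_left_mono add_left_mono ent marg_nonneg)
qed

lemma final_entropy:
  assumes "n < m"
  shows "(\<Sum>\<phi>\<in>agree I (A n) \<alpha>. P \<phi> * (\<Sum>z\<in>V. xlnx (final \<phi> z))) \<le>
    M (A n) \<alpha> * ((\<Sum>z\<in>V. xlnx (kernel n \<alpha> z)) + (\<Sum>j=n..<m-1. cost j (\<alpha> (c 0))))"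
proof -
  have "n \<le> m - 1" using assms(1) by simp
  thus ?thesis
  proof (induction arbitrary: \<alpha> rule: inc_induct)
    case base
    have const: "final \<phi> = final \<alpha>" if "\<phi> \<in> agree I (A (m - 1)) \<alpha>" for \<phi>
      using that m(1) by (intro kernel_cong) (auto simp: agree_def)
    have "(\<Sum>\<phi>\<in>agree I (A (m - 1)) \<alpha>. P \<phi> * G (final \<phi>)) = M (A (m - 1)) \<alpha> * G (final \<alpha>)" for G
      unfolding marg_def sum_distrib_right by (intro sum.cong refl arg_cong2[where f = "(*)"] arg_cong[where f = G] const)
    from this[of "\<lambda>f. \<Sum>z\<in>V. xlnx (f z)"] show ?case by simp
  next
    case (step k)
    hence k: "Suc k < m" by simp
    let ?u = "\<lambda>w. \<alpha>(c (Suc k) := w)"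
    let ?C = "\<Sum>j=Suc k..<m-1. cost j (\<alpha> (c 0))"
    have "(\<Sum>\<phi>\<in>agree I (A k) \<alpha>. P \<phi> * (\<Sum>z\<in>V. xlnx (final \<phi> z))) =
      (\<Sum>w\<in>V. \<Sum>\<phi>\<in>agree I (A (Suc k)) (?u w). P \<phi> * (\<Sum>z\<in>V. xlnx (final \<phi> z)))"
      unfolding sum_agree_split[OF finite_I next_in_I[OF k] next_notin_A[OF k]] A_Suc[symmetric] ..
    also have "\<dots> \<le> (\<Sum>w\<in>V. M (A (Suc k)) (?u w) * ((\<Sum>z\<in>V. xlnx (kernel (Suc k) (?u w) z)) + (\<Sum>j=Suc k..<m-1. cost j (?u w (c 0)))))"
      by (intro sum_mono step.IH)
    also have "\<dots> = (\<Sum>w\<in>V. M (A (Suc k)) (?u w) * (\<Sum>z\<in>V. xlnx (kernel (Suc k) (?u w) z))) + M (A k) \<alpha> * ?C"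
      unfolding marg_split[OF k, of \<alpha>] sum_distrib_right sum.distrib[symmetric] using next_neq_c0[OF k]
      by (intro sum.cong refl) (simp add: algebra_simps del: kernel.simps)
    also have "\<dots> \<le> M (A k) \<alpha> * ((\<Sum>z\<in>V. xlnx (kernel k \<alpha> z)) + cost k (\<alpha> (c 0))) + M (A k) \<alpha> * ?C"
      using kernel_entropy_step[OF k, of \<alpha>] by simp
    also have "\<dots> = M (A k) \<alpha> * ((\<Sum>z\<in>V. xlnx (kernel k \<alpha> z)) + (\<Sum>j=k..<m-1. cost j (\<alpha> (c 0))))"
      using step.hyps(2) by (simp add: sum.atLeast_Suc_lessThan algebra_simps)
    finally show ?case .
  qed
qed

lemma proper_final: "\<phi> \<in> I \<rightarrow>\<^sub>E V \<Longrightarrow> P \<phi> \<noteq> 0 \<Longrightarrow> proper (m - 1) \<phi>"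
proof -
  assume p: "\<phi> \<in> I \<rightarrow>\<^sub>E V" "P \<phi> \<noteq> 0"
  hence "0 < P \<phi>" using P_nonneg[of \<phi>] by simp
  also have "P \<phi> \<le> M (A (m - 1)) \<phi>"
    unfolding marg_def using p(1) P_nonneg finite_agree[OF finite_I]
    by (intro member_le_sum) (auto simp: agree_def)
  finally show ?thesis using proper[of "m - 1" \<phi>] m by simp
qed

text \<open>
  The final kernel need not be nonnegative for maps with values outside of \<open>V\<close>; the value 0 off the
  intended maps makes the weight nonnegative everywhere.
\<close>

definition extend :: "nat \<Rightarrow> (nat \<Rightarrow> 'a) \<Rightarrow> real" where
  "extend l \<phi> = (if \<phi> \<in> insert l I \<rightarrow>\<^sub>E V then P (restrict \<phi> I) * final \<phi> (\<phi> l) else 0)"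

lemma extend_upd:
  assumes "l \<notin> I" "\<phi> \<in> I \<rightarrow>\<^sub>E V" "z \<in> V"
  shows "extend l (\<phi>(l := z)) = P \<phi> * final \<phi> z"
proof -
  have "restrict (\<phi>(l := z)) I = \<phi>"
    using assms(1,2) by (auto simp: restrict_def fun_eq_iff PiE_def extensional_def)
  moreover have "final (\<phi>(l := z)) = final \<phi>"
    by (rule kernel_cong) (use m assms(1) A_last in auto)
  moreover have "\<phi>(l := z) \<in> insert l I \<rightarrow>\<^sub>E V" using assms by (auto intro!: PiE_fun_upd)
  ultimately show ?thesis by (simp add: extend_def)
qed

lemma sum_extend:
  assumes "l \<notin> I"
  shows "(\<Sum>\<phi>\<in>insert l I \<rightarrow>\<^sub>E V. G \<phi> (extend l \<phi>)) = (\<Sum>\<phi>\<in>I \<rightarrow>\<^sub>E V. \<Sum>z\<in>V. G (\<phi>(l := z)) (P \<phi> * final \<phi> z))"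
  unfolding sum_PiE_insert[OF assms] using assms by (intro sum.cong refl) (simp add: extend_upd)

lemma final_sum: "\<phi> \<in> I \<rightarrow>\<^sub>E V \<Longrightarrow> P \<phi> * (\<Sum>z\<in>V. final \<phi> z) = P \<phi>"
  using proper_final[of \<phi>] unfolding proper_def by (cases "P \<phi> = 0") auto

lemma restrict_I: "\<phi> \<in> insert l I \<rightarrow>\<^sub>E V \<Longrightarrow> restrict \<phi> I \<in> I \<rightarrow>\<^sub>E V"
  by (simp add: PiE_iff)

lemma final_restrict: "final (restrict \<phi> I) = final \<phi>"
  by (rule kernel_cong) (use m A_last in auto)

lemma extend_nonneg: "l \<notin> I \<Longrightarrow> 0 \<le> extend l \<phi>"
proof (cases "\<phi> \<in> insert l I \<rightarrow>\<^sub>E V \<and> P (restrict \<phi> I) \<noteq> 0")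
  case True
  assume l: "l \<notin> I"
  have r: "restrict \<phi> I \<in> I \<rightarrow>\<^sub>E V" using True restrict_I by blast
  hence "proper (m - 1) (restrict \<phi> I)" using True proper_final by blast
  moreover note final_restrict[of \<phi>]
  moreover have "\<phi> l \<in> V" using True PiE_mem[of \<phi> "insert l I" "\<lambda>_. V" l] by simp
  ultimately have "0 \<le> final \<phi> (\<phi> l)" unfolding proper_def by metis
  thus ?thesis using P_nonneg by (simp add: extend_def)
qed (auto simp: extend_def)

lemma extend_support:
  assumes "l \<notin> I" "extend l \<phi> \<noteq> 0"
  shows "P (restrict \<phi> I) \<noteq> 0" "restrict \<phi> I \<in> I \<rightarrow>\<^sub>E V" "\<phi> l \<in> N (\<phi> (c 0))" "\<phi> l \<notin> \<phi> ` I"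
proof -
  have p: "\<phi> \<in> insert l I \<rightarrow>\<^sub>E V" "P (restrict \<phi> I) \<noteq> 0" "final \<phi> (\<phi> l) \<noteq> 0"
    using assms(2) by (auto simp: extend_def split: if_splits)
  show r: "restrict \<phi> I \<in> I \<rightarrow>\<^sub>E V" using p(1) by (rule restrict_I)
  show "P (restrict \<phi> I) \<noteq> 0" by fact
  have "proper (m - 1) (restrict \<phi> I)" using p r proper_final by blast
  moreover note final_restrict[of \<phi>]
  moreover have "\<phi> l \<in> V" using p PiE_mem[of \<phi> "insert l I" "\<lambda>_. V" l] by simp
  moreover have "c 0 \<in> I" using c0_in_A[of "m-1"] A_last by simp
  ultimately show "\<phi> l \<in> N (\<phi> (c 0))" "\<phi> l \<notin> \<phi> ` I"
    using p(3) unfolding proper_def A_last by auto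
qed

lemma extend_marg_old:
  assumes "l \<notin> I" "B \<subseteq> I"
  shows "marg (insert l I) (extend l) B \<alpha> = M B \<alpha>"
proof -
  have "marg (insert l I) (extend l) B \<alpha> =
     (\<Sum>\<phi>\<in>I \<rightarrow>\<^sub>E V. \<Sum>z\<in>V. if \<forall>k\<in>B. (\<phi>(l := z)) k = \<alpha> k then P \<phi> * final \<phi> z else 0)"
    using marg_alt[of "insert l I" "extend l" B \<alpha>] finite_I
      sum_extend[OF assms(1), of "\<lambda>\<phi> x. if \<forall>k\<in>B. \<phi> k = \<alpha> k then x else 0"] by simp
  also have "\<dots> = (\<Sum>\<phi>\<in>I \<rightarrow>\<^sub>E V. if \<forall>k\<in>B. \<phi> k = \<alpha> k then P \<phi> else 0)"
  proof (intro sum.cong refl)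
    fix \<phi> assume "\<phi> \<in> I \<rightarrow>\<^sub>E V"
    have "(\<forall>k\<in>B. (\<phi>(l := z)) k = \<alpha> k) \<longleftrightarrow> (\<forall>k\<in>B. \<phi> k = \<alpha> k)" for z using assms by auto
    moreover have "(\<Sum>z\<in>V. if b then P \<phi> * final \<phi> z else 0) = (if b then P \<phi> * (\<Sum>z\<in>V. final \<phi> z) else 0)" for b
      by (simp add: sum_distrib_left)
    ultimately have "(\<Sum>z\<in>V. if \<forall>k\<in>B. (\<phi>(l := z)) k = \<alpha> k then P \<phi> * final \<phi> z else 0) =
      (if \<forall>k\<in>B. \<phi> k = \<alpha> k then P \<phi> * (\<Sum>z\<in>V. final \<phi> z) else 0)"
      by (simp only:)
    thus "(\<Sum>z\<in>V. if \<forall>k\<in>B. (\<phi>(l := z)) k = \<alpha> k then P \<phi> * final \<phi> z else 0) =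
      (if \<forall>k\<in>B. \<phi> k = \<alpha> k then P \<phi> else 0)" by (simp only: final_sum[OF \<open>\<phi> \<in> I \<rightarrow>\<^sub>E V\<close>])
  qed
  also have "\<dots> = M B \<alpha>" by (rule marg_alt[OF finite_I, symmetric])
  finally show ?thesis .
qed

lemma extend_marg_new:
  assumes "l \<notin> I" "n < m" "\<alpha> l \<in> V"
  shows "marg (insert l I) (extend l) (insert l (A n)) \<alpha> = M (A n) \<alpha> * kernel n \<alpha> (\<alpha> l)"
proof -
  have l: "l \<notin> A n" using assms A_sub by auto
  have "marg (insert l I) (extend l) (insert l (A n)) \<alpha> =
     (\<Sum>\<phi>\<in>I \<rightarrow>\<^sub>E V. \<Sum>z\<in>V. if \<forall>k\<in>insert l (A n). (\<phi>(l := z)) k = \<alpha> k then P \<phi> * final \<phi> z else 0)"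
    using marg_alt[of "insert l I" "extend l" "insert l (A n)" \<alpha>] finite_I
      sum_extend[OF assms(1), of "\<lambda>\<phi> x. if \<forall>k\<in>insert l (A n). \<phi> k = \<alpha> k then x else 0"] by simp
  also have "\<dots> = (\<Sum>\<phi>\<in>I \<rightarrow>\<^sub>E V. if \<forall>k\<in>A n. \<phi> k = \<alpha> k then P \<phi> * final \<phi> (\<alpha> l) else 0)"
  proof (intro sum.cong refl)
    fix \<phi>
    have "(\<forall>k\<in>insert l (A n). (\<phi>(l := z)) k = \<alpha> k) \<longleftrightarrow> z = \<alpha> l \<and> (\<forall>k\<in>A n. \<phi> k = \<alpha> k)" for z
      using l by auto
    hence "(\<Sum>z\<in>V. if \<forall>k\<in>insert l (A n). (\<phi>(l := z)) k = \<alpha> k then P \<phi> * final \<phi> z else 0) =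
      (\<Sum>z\<in>V. if z = \<alpha> l then (if \<forall>k\<in>A n. \<phi> k = \<alpha> k then P \<phi> * final \<phi> (\<alpha> l) else 0) else 0)"
      by (intro sum.cong refl) auto
    thus "(\<Sum>z\<in>V. if \<forall>k\<in>insert l (A n). (\<phi>(l := z)) k = \<alpha> k then P \<phi> * final \<phi> z else 0) =
      (if \<forall>k\<in>A n. \<phi> k = \<alpha> k then P \<phi> * final \<phi> (\<alpha> l) else 0)"
      using finite_V assms(3) by (simp only: sum.delta if_True)
  qed
  also have "\<dots> = (\<Sum>\<phi>\<in>agree I (A n) \<alpha>. P \<phi> * final \<phi> (\<alpha> l))"
    unfolding agree_def using finite_I finite_V
    by (subst sum.inter_filter[symmetric]) (auto intro!: finite_PiE)
  also have "\<dots> = M (A n) \<alpha> * kernel n \<alpha> (\<alpha> l)" by (rule final_marg[OF assms(2,3)])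
  finally show ?thesis .
qed

lemma extend_marg_out: "l \<notin> I \<Longrightarrow> \<alpha> l \<notin> V \<Longrightarrow> marg (insert l I) (extend l) (insert l B) \<alpha> = 0"
  unfolding marg_def agree_def by (intro sum.neutral) (auto dest: PiE_mem)

text \<open>
  This bound and \<open>extend_bound_next\<close> are the ones on which the attachment of later leaves relies: the
  probability of the leaf given an initial segment, and the probability of the next vertex given an
  initial segment together with the leaf. The number of edges conditioned on is \<open>n\<close> here and \<open>n + 1\<close>
  there.
\<close>

lemma extend_bound_new:
  assumes "l \<notin> I" "n < m" "1 \<le> n"
  shows "marg (insert l I) (extend l) (insert l (A n)) \<alpha> \<le> M (A n) \<alpha> / real (t - n)"
proof (cases "\<alpha> l \<in> V \<and> M (A n) \<alpha> \<noteq> 0")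
  case True
  hence M0: "0 < M (A n) \<alpha>" using marg_nonneg[of "A n" \<alpha>] by simp
  have v: "\<alpha> (c 0) \<in> V" using marg_pos_in_V[OF M0 A_sub c0_in_A] assms by simp
  have "kernel n \<alpha> (\<alpha> l) \<le> cap n (\<alpha> (c 0))"
    using proper[OF assms(2) M0] True unfolding proper_def by blast
  also have "\<dots> \<le> 1 / real (t - n)"
  proof -
    let ?d = "real (deg (\<alpha> (c 0)) - 1)"
    have "real (t - 1) \<le> ?d" "0 < ?d" using m min_degree[OF v] assms by linarith+
    hence "real (t - 1) / ?d \<le> 1" by simp
    hence "real (t - 1) / ?d / real (t - n) \<le> 1 / real (t - n)" by (intro divide_right_mono) auto
    moreover have "cap n (\<alpha> (c 0)) = real (t - 1) / ?d / real (t - n)"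
      unfolding cap_def divide_divide_eq_left by (rule if_not_P) (use assms(3) in simp)
    ultimately show ?thesis by (simp only:)
  qed
  finally have "M (A n) \<alpha> * kernel n \<alpha> (\<alpha> l) \<le> M (A n) \<alpha> * (1 / real (t - n))"
    using M0 by (intro mult_left_mono) auto
  thus ?thesis using extend_marg_new[of l n \<alpha>] assms True by simp
next
  case False
  hence "marg (insert l I) (extend l) (insert l (A n)) \<alpha> = 0"
    using extend_marg_out[OF assms(1), of \<alpha>] extend_marg_new[of l n \<alpha>] assms by (cases "\<alpha> l \<in> V") auto
  thus ?thesis using marg_nonneg by simp
qed

lemma extend_bound_next:
  assumes "l \<notin> I" "Suc n < m"
  shows "marg (insert l I) (extend l) (insert l (A (Suc n))) \<alpha> \<le>
    marg (insert l I) (extend l) (insert l (A n)) \<alpha> / real (t - Suc n)"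
proof (cases "\<alpha> l \<in> V")
  case True
  thus ?thesis using extend_marg_new[of l "Suc n" \<alpha>] extend_marg_new[of l n \<alpha>] assms
      kernel_mass_bound[OF assms(2) True, of \<alpha>] by (simp del: kernel.simps)
qed (simp add: extend_marg_out[OF assms(1)])

lemma extend_edge:
  assumes "l \<notin> I" "\<alpha> l \<in> V"
  shows "marg (insert l I) (extend l) {l, c 0} \<alpha> =
    M {c 0} \<alpha> * (if \<alpha> l \<in> N (\<alpha> (c 0)) then 1 / real (deg (\<alpha> (c 0))) else 0)"
  using extend_marg_new[of l 0 \<alpha>] assms m by (simp add: A_def)

lemma extend_one: "l \<notin> I \<Longrightarrow> sum (extend l) (insert l I \<rightarrow>\<^sub>E V) = 1"
proof -
  assume l: "l \<notin> I"
  have "sum (extend l) (insert l I \<rightarrow>\<^sub>E V) = (\<Sum>\<phi>\<in>I \<rightarrow>\<^sub>E V. P \<phi> * (\<Sum>z\<in>V. final \<phi> z))"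
    using sum_extend[OF l, of "\<lambda>_ x. x"] by (simp add: sum_distrib_left)
  also have "\<dots> = sum P (I \<rightarrow>\<^sub>E V)" by (intro sum.cong refl final_sum)
  finally show ?thesis using P_one by simp
qed

lemma extend_entropy:
  assumes "l \<notin> I"
  shows "(\<Sum>\<phi>\<in>insert l I \<rightarrow>\<^sub>E V. xlnx (extend l \<phi>)) \<le> (\<Sum>\<phi>\<in>I \<rightarrow>\<^sub>E V. xlnx (P \<phi>)) +
    (\<Sum>v\<in>V. M {c 0} (\<lambda>_. v) * ((\<Sum>j<m-1. cost j v) - ln (real (deg v))))"
proof -
  have "(\<Sum>\<phi>\<in>insert l I \<rightarrow>\<^sub>E V. xlnx (extend l \<phi>)) = (\<Sum>\<phi>\<in>I \<rightarrow>\<^sub>E V. \<Sum>z\<in>V. xlnx (P \<phi> * final \<phi> z))"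
    by (rule sum_extend[OF assms])
  also have "\<dots> = (\<Sum>\<phi>\<in>I \<rightarrow>\<^sub>E V. xlnx (P \<phi>) + P \<phi> * (\<Sum>z\<in>V. xlnx (final \<phi> z)))"
  proof (intro sum.cong refl)
    fix \<phi> assume p: "\<phi> \<in> I \<rightarrow>\<^sub>E V"
    show "(\<Sum>z\<in>V. xlnx (P \<phi> * final \<phi> z)) = xlnx (P \<phi>) + P \<phi> * (\<Sum>z\<in>V. xlnx (final \<phi> z))"
    proof (cases "P \<phi> = 0")
      case False
      hence g: "proper (m - 1) \<phi>" using p proper_final by blast
      have "(\<Sum>z\<in>V. xlnx (P \<phi> * final \<phi> z)) = (\<Sum>z\<in>V. xlnx (P \<phi>) * final \<phi> z + P \<phi> * xlnx (final \<phi> z))"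
        using g P_nonneg unfolding proper_def by (intro sum.cong refl) (simp add: xlnx_mult)
      also have "\<dots> = xlnx (P \<phi>) * sum (final \<phi>) V + P \<phi> * (\<Sum>z\<in>V. xlnx (final \<phi> z))"
        by (simp only: sum.distrib sum_distrib_left)
      finally show ?thesis using g unfolding proper_def by simp
    qed simp
  qed
  also have "\<dots> = (\<Sum>\<phi>\<in>I \<rightarrow>\<^sub>E V. xlnx (P \<phi>)) + (\<Sum>\<phi>\<in>I \<rightarrow>\<^sub>E V. P \<phi> * (\<Sum>z\<in>V. xlnx (final \<phi> z)))"
    by (rule sum.distrib)
  also have "(\<Sum>\<phi>\<in>I \<rightarrow>\<^sub>E V. P \<phi> * (\<Sum>z\<in>V. xlnx (final \<phi> z))) \<le>
     (\<Sum>v\<in>V. M {c 0} (\<lambda>_. v) * ((\<Sum>j<m-1. cost j v) - ln (real (deg v))))"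
  proof -
    have c0: "c 0 \<in> I" using c0_in_A[of "m-1"] A_last by simp
    have "I \<rightarrow>\<^sub>E V = agree I {} undefined" by (simp add: agree_def)
    hence "(\<Sum>\<phi>\<in>I \<rightarrow>\<^sub>E V. P \<phi> * (\<Sum>z\<in>V. xlnx (final \<phi> z))) =
      (\<Sum>v\<in>V. \<Sum>\<phi>\<in>agree I {c 0} (undefined(c 0 := v)). P \<phi> * (\<Sum>z\<in>V. xlnx (final \<phi> z)))"
      using sum_agree_split[OF finite_I c0, of "{}"] by simp
    also have "\<dots> = (\<Sum>v\<in>V. \<Sum>\<phi>\<in>agree I (A 0) (\<lambda>_. v). P \<phi> * (\<Sum>z\<in>V. xlnx (final \<phi> z)))"
      by (intro sum.cong agree_cong refl) (auto simp: agree_def A_def)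
    also have "\<dots> \<le> (\<Sum>v\<in>V. M (A 0) (\<lambda>_. v) * ((\<Sum>z\<in>V. xlnx (kernel 0 (\<lambda>_. v) z)) + (\<Sum>j=0..<m-1. cost j v)))"
      using m(1) by (intro sum_mono final_entropy[of 0]) simp
    also have "\<dots> = (\<Sum>v\<in>V. M {c 0} (\<lambda>_. v) * ((\<Sum>j<m-1. cost j v) - ln (real (deg v))))"
    proof (intro sum.cong refl)
      fix v assume v: "v \<in> V"
      have d: "0 < deg v" using min_degree[OF v] t_pos by simp
      have "(\<Sum>z\<in>V. xlnx (kernel 0 (\<lambda>_. v) z)) = (\<Sum>z\<in>N v. xlnx (1 / real (deg v)))"
        using finite_V N_sub[OF v] by (intro sum.mono_neutral_cong_right) auto
      also have "\<dots> = - ln (real (deg v))" using d by (simp add: xlnx_def ln_div)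
      finally show "M (A 0) (\<lambda>_. v) * ((\<Sum>z\<in>V. xlnx (kernel 0 (\<lambda>_. v) z)) + (\<Sum>j=0..<m-1. cost j v)) =
        M {c 0} (\<lambda>_. v) * ((\<Sum>j<m-1. cost j v) - ln (real (deg v)))"
        by (simp add: A_def lessThan_atLeast0)
    qed
    finally show ?thesis .
  qed
  finally show ?thesis by simp
qed

end

section \<open>Depth-first numbering of a tree\<close>

text \<open>
  The vertices of a rooted tree are numbers, and \<open>par\<close> maps each vertex to its parent. A vertex is a root
  if \<open>par\<close> does not decrease it. The relation \<open>anc par a k\<close> says that \<open>a\<close> is \<open>k\<close> or an ancestor
  of \<open>k\<close>.
\<close>

inductive anc :: "(nat \<Rightarrow> nat) \<Rightarrow> nat \<Rightarrow> nat \<Rightarrow> bool" for par where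
  anc_refl: "anc par a a"
| anc_step: "par k < k \<Longrightarrow> anc par a (par k) \<Longrightarrow> anc par a k"

lemma anc_le: "anc par a k \<Longrightarrow> a \<le> k"
  by (induction rule: anc.induct) auto

lemma anc_cases: "anc par a k \<Longrightarrow> a \<noteq> k \<Longrightarrow> par k < k \<and> anc par a (par k)"
  by (auto elim: anc.cases)

lemma anc_trans: "anc par b c \<Longrightarrow> anc par a b \<Longrightarrow> anc par a c"
  by (induction rule: anc.induct) (auto intro: anc_step)

text \<open>
  In a depth-first numbering this lists everything that was numbered before \<open>a\<close>: the parent of \<open>a\<close> with its
  branches before \<open>a\<close>, then the grandparent with its earlier branches, and so on up to the root.
\<close>

function up :: "(nat \<Rightarrow> nat) \<Rightarrow> nat \<Rightarrow> nat list" where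
  "up par a = (if par a < a then [par a..<a] @ up par (par a) else [])"
  by pat_completeness auto
termination by (relation "measure snd") auto

declare up.simps [simp del]

lemma up_step: "par a < a \<Longrightarrow> up par a = [par a..<a] @ up par (par a)"
  by (subst up.simps) simp

lemma up_root: "\<not> par a < a \<Longrightarrow> up par a = []"
  by (subst up.simps) simp

lemma anc_up: "anc par b a \<Longrightarrow> \<exists>zs. up par a = zs @ up par b \<and> set zs = {b..<a} \<and> length zs = a - b"
proof (induction rule: anc.induct)
  case (anc_step k a)
  then obtain zs where zs: "up par (par k) = zs @ up par a" "set zs = {a..<par k}" "length zs = par k - a" by blast
  have "a \<le> par k" using anc_step.hyps(2) by (rule anc_le)
  hence "{par k..<k} \<union> {a..<par k} = {a..<k}" "k - par k + (par k - a) = k - a"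
    using anc_step.hyps(1) by auto
  thus ?case using zs up_step[of par k, OF anc_step.hyps(1)] by (intro exI[of _ "[par k..<k] @ zs"]) simp
qed simp

text \<open>
  A numbering is depth-first if each vertex is attached to the path from the root to the vertex
  numbered just before.
\<close>

definition dfs :: "(nat \<Rightarrow> nat) \<Rightarrow> nat \<Rightarrow> bool" where
  "dfs par t \<longleftrightarrow> (\<forall>k. 1 \<le> k \<and> k \<le> t \<longrightarrow> par k < k) \<and> (\<forall>k<t. anc par (par (Suc k)) k)"

lemma set_up: "dfs par t \<Longrightarrow> a \<le> t \<Longrightarrow> set (up par a) = {..<a} \<and> distinct (up par a)"
proof (induction a rule: less_induct)
  case (less a)
  show ?case
  proof (cases "a = 0")
    case True thus ?thesis by (simp add: up_root)
  next
    case False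
    hence p: "par a < a" using less.prems unfolding dfs_def by simp
    have "par a \<le> t" using p less.prems(2) by simp
    from less.IH[OF p less.prems(1) this]
    have u: "set (up par (par a)) = {..<par a}" "distinct (up par (par a))" by blast+
    have "{par a..<a} \<union> {..<par a} = {..<a}" "{par a..<a} \<inter> {..<par a} = {}" using p by auto
    thus ?thesis unfolding up_step[of par a, OF p] by (simp add: u)
  qed
qed

text \<open>
  The descendants of a vertex are numbered without interruption.
\<close>

lemma anc_contiguous:
  assumes "dfs par t"
  shows "i \<le> t \<Longrightarrow> anc par a i \<Longrightarrow> a \<le> k \<Longrightarrow> k \<le> i \<Longrightarrow> anc par a k"
proof (induction i)
  case 0 thus ?case using anc_refl by (metis le_zero_eq)
next
  case (Suc i)
  show ?case
  proof (cases "k = Suc i \<or> k = a")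
    case True thus ?thesis using Suc.prems anc_refl by auto
  next
    case False
    hence "anc par a (par (Suc i))" using Suc.prems anc_cases by fastforce
    moreover have "anc par (par (Suc i)) i" using assms Suc.prems unfolding dfs_def by auto
    ultimately have "anc par a i" by (rule anc_trans[rotated])
    thus ?thesis using Suc False by auto
  qed
qed

text \<open>
  A traversal of the tree on \<open>{..i}\<close> from a vertex \<open>a\<close> on the path to \<open>i\<close>: the
  descendants of \<open>a\<close> come first, then everything else from the bottom up. Every initial segment is a subtree.
\<close>

definition chain :: "(nat \<Rightarrow> nat) \<Rightarrow> nat \<Rightarrow> nat \<Rightarrow> nat list" where
  "chain par i a = [a..<Suc i] @ up par a"

lemma chain_props:
  assumes "dfs par t" "i \<le> t" "a \<le> i"
  shows "set (chain par i a) = {..i}" "distinct (chain par i a)" "length (chain par i a) = Suc i"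
proof -
  have "a \<le> t" using assms(2,3) by simp
  from set_up[OF assms(1) this] have u: "set (up par a) = {..<a}" "distinct (up par a)" by blast+
  have "set (chain par i a) = {a..<Suc i} \<union> {..<a}" by (simp only: chain_def set_append set_upt u)
  also have "\<dots> = {..i}" using assms(3) by auto
  finally show s: "set (chain par i a) = {..i}" .
  have "{a..<Suc i} \<inter> {..<a} = {}" by auto
  thus d: "distinct (chain par i a)" by (simp only: chain_def distinct_append set_upt u distinct_upt)
  show "length (chain par i a) = Suc i" using distinct_card[OF d] unfolding s by simp
qed

lemma chain_nth0: "a \<le> i \<Longrightarrow> chain par i a ! 0 = a"
  unfolding chain_def by (simp add: upt_conv_Cons del: upt_Suc)

lemma chain_nth1:
  assumes "dfs par t" "i \<le> t" "anc par a i" "1 \<le> i"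
  shows "\<exists>k. 1 \<le> k \<and> k \<le> i \<and> {chain par i a ! 0, chain par i a ! 1} = {k, par k}"
proof (cases "a = i")
  case True
  have "par i < i" using assms unfolding dfs_def by auto
  hence "chain par i a ! 1 = par i" using True by (simp add: chain_def up_step upt_conv_Cons del: upt_Suc)
  thus ?thesis using True chain_nth0[of a i par] assms(4) \<open>par i < i\<close> by (intro exI[of _ i]) auto
next
  case False
  hence a: "a < i" using anc_le[OF assms(3)] by simp
  have "anc par a (Suc a)" using anc_contiguous[OF assms(1,2,3)] a by auto
  hence "par (Suc a) < Suc a \<and> anc par a (par (Suc a))" using anc_cases[of par a "Suc a"] by simp
  hence "par (Suc a) = a" using anc_le[of par a "par (Suc a)"] by simp
  moreover have "chain par i a ! 1 = Suc a" using a by (simp add: chain_def upt_conv_Cons del: upt_Suc)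
  ultimately show ?thesis using chain_nth0[of a i par] a by (intro exI[of _ "Suc a"]) auto
qed

lemma take_nth_image: "n < length xs \<Longrightarrow> (\<lambda>k. xs ! k) ` {..n} = set (take (Suc n) xs)"
  using nth_image[of "Suc n" xs] by (simp add: atLeast0LessThan lessThan_Suc_atMost)

text \<open>
  The chains of the tree with the additional vertex \<open>Suc i\<close> are related to a single chain of the old tree, the
  one from the parent of \<open>Suc i\<close>. The chain from \<open>Suc i\<close> itself is that chain with \<open>Suc i\<close> in
  front. For an ancestor \<open>b\<close>, the chain from \<open>b\<close> reaches \<open>Suc i\<close> after all old descendants of \<open>b\<close>. From there on its
  segments are, as sets, segments of the chain from the parent with \<open>Suc i\<close> added. For this reason the
  bounds obtained from attaching \<open>Suc i\<close> suffice for attaching the next vertex.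
\<close>

lemma chain_Suc_self: "par (Suc i) < Suc i \<Longrightarrow> chain par (Suc i) (Suc i) = Suc i # chain par i (par (Suc i))"
  by (simp add: chain_def up_step)

lemma chain_Suc_anc:
  assumes "anc par b (par (Suc i))" "par (Suc i) \<le> i" "Suc i - b \<le> k"
  shows "set (take (Suc k) (chain par (Suc i) b)) = insert (Suc i) (set (take k (chain par i (par (Suc i)))))"
proof -
  define a where "a = par (Suc i)"
  obtain zs where zs: "up par a = zs @ up par b" "set zs = {b..<a}" "length zs = a - b"
    using anc_up assms(1) unfolding a_def by blast
  have ba: "b \<le> a" "a \<le> i" using anc_le[OF assms(1)] assms(2) unfolding a_def by auto
  let ?r = "k - (Suc i - b)"
  have "chain par (Suc i) b = [b..<Suc i] @ Suc i # up par b" using ba by (simp add: chain_def)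
  hence "take (Suc k) (chain par (Suc i) b) = [b..<Suc i] @ Suc i # take ?r (up par b)"
    using assms(3) by (simp add: Suc_diff_le del: upt_Suc)
  hence 1: "set (take (Suc k) (chain par (Suc i) b)) = insert (Suc i) ({b..<Suc i} \<union> set (take ?r (up par b)))"
    by (simp del: upt_Suc)
  have "chain par i a = ([a..<Suc i] @ zs) @ up par b" by (simp add: chain_def zs(1) del: upt_Suc)
  moreover have "length ([a..<Suc i] @ zs) = Suc i - b" using ba zs(3) by (simp del: upt_Suc)
  ultimately have "take k (chain par i a) = ([a..<Suc i] @ zs) @ take ?r (up par b)"
    using assms(3) by (simp del: upt_Suc append_assoc)
  hence "set (take k (chain par i a)) = ({a..<Suc i} \<union> {b..<a}) \<union> set (take ?r (up par b))"
    by (simp add: zs(2) Un_assoc del: upt_Suc)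
  moreover have "{a..<Suc i} \<union> {b..<a} = {b..<Suc i}" using ba by auto
  ultimately show ?thesis unfolding 1 a_def by simp
qed

lemma anc_linear: "anc par a m \<Longrightarrow> anc par b m \<Longrightarrow> a \<le> b \<Longrightarrow> anc par a b"
proof (induction arbitrary: rule: anc.induct)
  case (anc_refl a) thus ?case using anc_le[of par b a] anc.anc_refl by (metis antisym)
next
  case (anc_step k a)
  show ?case
  proof (cases "b = k")
    case True thus ?thesis using anc_step.hyps anc.anc_step by blast
  next
    case False
    thus ?thesis using anc_step anc_cases[of par b k] by blast
  qed
qed

lemma anc_cong:
  "anc par a k \<Longrightarrow> (\<And>j. j \<le> k \<Longrightarrow> par' j = par j) \<Longrightarrow> anc par' a k"
proof (induction rule: anc.induct)
  case (anc_refl a) show ?case by (rule anc.anc_refl)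
next
  case (anc_step k a)
  have eq: "par' k = par k" by (rule anc_step.prems) simp
  have "anc par' a (par k)"
  proof (rule anc_step.IH)
    fix j assume "j \<le> par k"
    thus "par' j = par j" using anc_step.prems[of j] anc_step.hyps(1) by simp
  qed
  thus ?case using anc_step.hyps(1) unfolding eq[symmetric] by (rule anc.anc_step[rotated])
qed

text \<open>
  A depth-first search that has visited \<open>f 0, \<dots>, f m\<close>. Only vertices on the path to \<open>f m\<close> may have
  unvisited neighbours, and every edge between visited vertices joins a vertex to one of its
  ancestors.
\<close>

definition search :: "'b rel \<Rightarrow> 'b set \<Rightarrow> (nat \<Rightarrow> 'b) \<Rightarrow> (nat \<Rightarrow> nat) \<Rightarrow> nat \<Rightarrow> bool" where
  "search E X f par m \<longleftrightarrow> dfs par m \<and> inj_on f {..m} \<and> f ` {..m} \<subseteq> X \<and>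
    (\<forall>k. 1 \<le> k \<and> k \<le> m \<longrightarrow> (f k, f (par k)) \<in> E) \<and>
    (\<forall>j\<le>m. \<forall>w\<in>X. (f j, w) \<in> E \<longrightarrow> w \<notin> f ` {..m} \<longrightarrow> anc par j m) \<and>
    (\<forall>j k. j < k \<longrightarrow> k \<le> m \<longrightarrow> (f j, f k) \<in> E \<longrightarrow> anc par j k)"

text \<open>
  The search continues from the last visited vertex that has an unvisited neighbour. All
  such vertices lie on the current path, so they are ancestors of the one that is chosen and hence of the new vertex.
\<close>

lemma search_extend:
  assumes s: "search E X f par m" and w: "w \<in> X" "w \<notin> f ` {..m}" "\<exists>j\<le>m. (f j, w) \<in> E"
    and sym: "sym E"
  shows "\<exists>f' par'. search E X f' par' (Suc m)"
proof -
  note S = s[unfolded search_def]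
  define unfinished where "unfinished = {j. j \<le> m \<and> (\<exists>x\<in>X. (f j, x) \<in> E \<and> x \<notin> f ` {..m})}"
  have fin: "finite unfinished" unfolding unfinished_def by simp
  have ne: "unfinished \<noteq> {}" using w unfolding unfinished_def by blast
  define p where "p = Max unfinished"
  have p: "p \<in> unfinished" "\<And>j. j \<in> unfinished \<Longrightarrow> j \<le> p"
    using Max_in[OF fin ne] Max_ge[OF fin] unfolding p_def by auto
  obtain x where x: "x \<in> X" "(f p, x) \<in> E" "x \<notin> f ` {..m}" and pm: "p \<le> m"
    using p(1) unfolding unfinished_def by blast
  have path: "anc par j m" if "j \<in> unfinished" for j using that S unfolding unfinished_def by blast
  define f' where "f' = f(Suc m := x)"
  define par' where "par' = par(Suc m := p)"
  have f'[simp]: "f' j = f j" "par' j = par j" if "j \<le> m" for j using that by (auto simp: f'_def par'_def)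
  have new[simp]: "f' (Suc m) = x" "par' (Suc m) = p" by (auto simp: f'_def par'_def)
  have img: "f' ` {..Suc m} = insert x (f ` {..m})" by (auto simp: atMost_Suc)
  have anc': "anc par' j k" if "anc par j k" "k \<le> m" for j k
    by (rule anc_cong[OF that(1)]) (use that(2) in simp)
  have to_new: "anc par' j (Suc m)" if "j \<in> unfinished" for j
  proof -
    have "anc par j p" using anc_linear[OF path[OF that] path[OF p(1)] p(2)[OF that]] .
    hence "anc par' j p" using pm by (rule anc')
    hence "anc par' j (par' (Suc m))" "par' (Suc m) < Suc m" using pm by simp_all
    thus ?thesis by (rule anc_step[rotated])
  qed
  have "dfs par' (Suc m)" unfolding dfs_def
  proof (intro conjI allI impI)
    fix k assume "1 \<le> k \<and> k \<le> Suc m"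
    thus "par' k < k" using S pm unfolding dfs_def by (cases "k = Suc m") auto
  next
    fix k assume k: "k < Suc m"
    show "anc par' (par' (Suc k)) k"
    proof (cases "k = m")
      case True thus ?thesis using anc'[OF path[OF p(1)]] by simp
    next
      case False
      hence "anc par (par (Suc k)) k" using k S unfolding dfs_def by auto
      thus ?thesis using False k by (auto intro: anc')
    qed
  qed
  moreover have "inj_on f' {..Suc m}"
  proof -
    have "inj_on f' {..m} \<longleftrightarrow> inj_on f {..m}" by (rule inj_on_cong) simp
    hence "inj_on f' {..m}" using S by blast
    moreover have "f' (Suc m) \<notin> f' ` {..m}" using x(3) by auto
    moreover have "{..m} - {Suc m} = {..m}" by auto
    ultimately show ?thesis unfolding atMost_Suc inj_on_insert by simp
  qed
  moreover have "f' ` {..Suc m} \<subseteq> X" using S x(1) unfolding img by blast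
  moreover have "(f' k, f' (par' k)) \<in> E" if "1 \<le> k" "k \<le> Suc m" for k
  proof (cases "k = Suc m")
    case True thus ?thesis using symD[OF sym x(2)] pm by simp
  next
    case False
    hence "k \<le> m" "par k < k" using that S unfolding dfs_def by auto
    thus ?thesis using that S by simp
  qed
  moreover have "anc par' j (Suc m)" if "j \<le> Suc m" "y \<in> X" "(f' j, y) \<in> E" "y \<notin> f' ` {..Suc m}" for j y
  proof (cases "j = Suc m")
    case True thus ?thesis by (simp add: anc_refl)
  next
    case False
    hence "j \<in> unfinished" using that unfolding img unfinished_def by auto
    thus ?thesis by (rule to_new)
  qed
  moreover have "anc par' j k" if "j < k" "k \<le> Suc m" "(f' j, f' k) \<in> E" for j k
  proof (cases "k = Suc m")
    case True
    hence "j \<in> unfinished" using that x unfolding unfinished_def by auto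
    thus ?thesis unfolding True by (rule to_new)
  next
    case False
    hence "anc par j k" using that S by auto
    thus ?thesis using False that by (intro anc') auto
  qed
  ultimately show ?thesis unfolding search_def by blast
qed

lemma search_complete:
  assumes "finite X" "X \<noteq> {}" "sym E"
    and conn: "\<And>Y. Y \<subseteq> X \<Longrightarrow> Y \<noteq> {} \<Longrightarrow> Y \<noteq> X \<Longrightarrow> \<exists>y\<in>Y. \<exists>w\<in>X - Y. (y, w) \<in> E"
  shows "\<exists>f par m. search E X f par m \<and> f ` {..m} = X"
proof -
  have card: "card (f ` {..m}) = Suc m" if "search E X f par m" for f par m
    using that unfolding search_def by (simp add: card_image)
  have "\<exists>f par. search E X f par m" if "m < card X" for m
    using that
  proof (induction m)
    case 0
    obtain r where "r \<in> X" using assms(2) by blast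
    hence "search E X (\<lambda>_. r) (\<lambda>k. 0) 0"
      unfolding search_def dfs_def by (auto simp: anc_refl)
    thus ?case by blast
  next
    case (Suc m)
    then obtain f par where s: "search E X f par m" by auto
    have "f ` {..m} \<noteq> X" using card[OF s] Suc.prems by auto
    moreover have "f ` {..m} \<subseteq> X" "f ` {..m} \<noteq> {}" using s unfolding search_def by auto
    ultimately obtain y w where "y \<in> f ` {..m}" "w \<in> X - f ` {..m}" "(y, w) \<in> E"
      using conn[of "f ` {..m}"] by blast
    hence "w \<in> X" "w \<notin> f ` {..m}" "\<exists>j\<le>m. (f j, w) \<in> E" by auto
    from search_extend[OF s this assms(3)] show ?case .
  qed
  from this[of "card X - 1"] obtain f par where s: "search E X f par (card X - 1)"
    using assms(1,2) by (auto simp: card_gt_0_iff)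
  have "card (f ` {..card X - 1}) = card X"
    using card[OF s] assms(1,2) by (simp add: card_gt_0_iff)
  hence "f ` {..card X - 1} = X" using s assms(1) unfolding search_def by (intro card_subset_eq) auto
  thus ?thesis using s by blast
qed

text \<open>
  The path in the search tree from a vertex up to an ancestor.
\<close>

lemma climb:
  assumes s: "search E X f par m" and "anc par j k" "k \<le> m"
  shows "\<exists>p. pcas (f k) p (f j) \<and> set p \<subseteq> E \<and> distinct (pawalk_verts (f k) p) \<and>
    set (pawalk_verts (f k) p) \<subseteq> f ` {..k} \<and> (j \<noteq> k \<longrightarrow> 1 \<le> length p) \<and> (j \<noteq> k \<longrightarrow> j \<noteq> par k \<longrightarrow> 2 \<le> length p)"
  using assms(2,3)
proof (induction rule: anc.induct)
  case (anc_refl a)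
  show ?case by (intro exI[of _ "[]"]) auto
next
  case (anc_step k a)
  have k: "par k \<le> m" "1 \<le> k" using anc_step.hyps(1) anc_step.prems by auto
  then obtain p where p: "pcas (f (par k)) p (f a)" "set p \<subseteq> E" "distinct (pawalk_verts (f (par k)) p)"
    "set (pawalk_verts (f (par k)) p) \<subseteq> f ` {..par k}" "a \<noteq> par k \<longrightarrow> 1 \<le> length p"
    using anc_step.IH by blast
  have "f k \<notin> f ` {..par k}"
  proof
    assume "f k \<in> f ` {..par k}"
    then obtain l where "l \<le> par k" "f k = f l" by auto
    moreover have "inj_on f {..m}" using s unfolding search_def by blast
    ultimately have "k = l" using anc_step.prems k by (auto dest: inj_onD)
    thus False using \<open>l \<le> par k\<close> anc_step.hyps(1) by simp
  qed
  moreover have "(f k, f (par k)) \<in> E" using s k anc_step.prems unfolding search_def by blast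
  moreover have "f ` {..par k} \<subseteq> f ` {..k}" using anc_step.hyps(1) by auto
  ultimately show ?case using p by (intro exI[of _ "(f k, f (par k)) # p"]) auto
qed

text \<open>
  Every edge joins a vertex to an ancestor. If that ancestor is not the parent, then the edge and the
  path in the search tree form a cycle of length at least 3. So the edges are exactly the pairs of a vertex and its parent, and
  their number is the largest index of the numbering.
\<close>

lemma tree_depth_first_order:
  assumes "undirected_tree T"
  shows "\<exists>f par. dfs par (card (uedges T)) \<and> bij_betw f {..card (uedges T)} (pverts T) \<and>
    (\<forall>u v. (u, v) \<in> parcs T \<longrightarrow> (\<exists>k. 1 \<le> k \<and> k \<le> card (uedges T) \<and> {u, v} = {f k, f (par k)}))"
proof -
  have "pair_graph T" and conn: "connected (with_proj T)"
    and acyclic: "\<And>p. pre_digraph.cycle (with_proj T) p \<Longrightarrow> length p < 3"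
    using assms unfolding undirected_tree_def by (auto simp: not_le)
  interpret pair_graph T by fact
  have sym: "sym (parcs T)" using pair_sym_arcs by (simp add: symmetric_def)
  have strong: "strongly_connected (with_proj T)"
    using symmetric_connected_imp_strongly_connected[OF _ conn] sym_arcs by blast
  have "\<exists>f par m. search (parcs T) (pverts T) f par m \<and> f ` {..m} = pverts T"
  proof (rule search_complete)
    show "finite (pverts T)" by simp
    show "pverts T \<noteq> {}" using strong by (auto simp: strongly_connected_def)
    show "sym (parcs T)" by fact
    fix Y assume Y: "Y \<subseteq> pverts T" "Y \<noteq> {}" "Y \<noteq> pverts T"
    show "\<exists>y\<in>Y. \<exists>w\<in>pverts T - Y. (y, w) \<in> parcs T"
    proof (rule ccontr)
      assume closed: "\<not> ?thesis"
      obtain u v where uv: "u \<in> Y" "v \<in> pverts T" "v \<notin> Y" using Y by blast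
      have "u \<rightarrow>\<^sup>*\<^bsub>with_proj T\<^esub> v" using strong uv Y(1) by (auto simp: strongly_connected_def)
      hence "v \<in> Y"
      proof (induction rule: reachable_induct)
        case base show ?case by fact
      next
        case (step x y)
        thus ?case using closed in_arcsD2[of x y] by auto
      qed
      thus False using uv(3) by simp
    qed
  qed
  then obtain f par m where s: "search (parcs T) (pverts T) f par m" and img: "f ` {..m} = pverts T" by blast
  note S = s[unfolded search_def]
  have tree_arc: "(f j, f k) \<in> parcs T \<Longrightarrow> j < k \<Longrightarrow> k \<le> m \<Longrightarrow> j = par k" for j k
  proof (rule ccontr)
    assume e: "(f j, f k) \<in> parcs T" "j < k" "k \<le> m" "j \<noteq> par k"
    hence "anc par j k" using S by blast
    from climb[OF s this e(3)] obtain p where p: "pcas (f k) p (f j)" "set p \<subseteq> parcs T"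
      "distinct (pawalk_verts (f k) p)" "2 \<le> length p" using e by blast
    have "f j \<in> pverts T" using e(1) by (rule in_arcsD1)
    hence "pre_digraph.cycle (with_proj T) ((f j, f k) # p)"
      unfolding pre_digraph.cycle_def pre_digraph.awalk_def using p e(1)
      by (intro exI[of _ "f j"]) (simp add: cas_with_proj_eq awalk_verts_with_proj_eq)
    from acyclic[OF this] p(4) show False by simp
  qed
  have inj: "inj_on f {..m}" and par: "\<And>k. 1 \<le> k \<Longrightarrow> k \<le> m \<Longrightarrow> par k < k"
    using S unfolding dfs_def by auto
  have arcs: "\<exists>k. 1 \<le> k \<and> k \<le> m \<and> {u, v} = {f k, f (par k)}" if uv: "(u, v) \<in> parcs T" for u v
  proof -
    obtain i j where ij: "i \<le> m" "j \<le> m" "u = f i" "v = f j"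
      using in_arcsD1[OF uv] in_arcsD2[OF uv] unfolding img[symmetric] by auto
    have "i \<noteq> j" using pair_no_loops[OF uv] ij by auto
    moreover have "(f j, f i) \<in> parcs T" "(f i, f j) \<in> parcs T" using uv symD[OF sym uv] ij by simp_all
    ultimately consider "i < j" "i = par j" | "j < i" "j = par i"
      using tree_arc[of i j] tree_arc[of j i] ij by linarith
    thus ?thesis
    proof cases
      case 1
      have "{u, v} = {f j, f (par j)}" unfolding ij(3,4) 1(2)[symmetric] by (rule insert_commute)
      thus ?thesis using 1(1) ij(2) by (intro exI[of _ j]) simp
    next
      case 2
      have "{u, v} = {f i, f (par i)}" unfolding ij(3,4) 2(2)[symmetric] ..
      thus ?thesis using 2(1) ij(1) by (intro exI[of _ i]) simp
    qed
  qed
  have "uedges T = (\<lambda>k. {f k, f (par k)}) ` {1..m}"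
  proof
    show "uedges T \<subseteq> (\<lambda>k. {f k, f (par k)}) ` {1..m}"
    proof
      fix e assume "e \<in> uedges T"
      then obtain u v where uv: "e = {u, v}" "(u, v) \<in> parcs T" unfolding uedges_def by blast
      from arcs[OF uv(2)] obtain k where "1 \<le> k" "k \<le> m" "{u, v} = {f k, f (par k)}" by blast
      thus "e \<in> (\<lambda>k. {f k, f (par k)}) ` {1..m}" unfolding uv(1) by (intro image_eqI[of _ _ k]) simp_all
    qed
    show "(\<lambda>k. {f k, f (par k)}) ` {1..m} \<subseteq> uedges T"
    proof
      fix e assume "e \<in> (\<lambda>k. {f k, f (par k)}) ` {1..m}"
      then obtain k where k: "1 \<le> k" "k \<le> m" "e = {f k, f (par k)}" by auto
      hence "(f k, f (par k)) \<in> parcs T" using S by blast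
      thus "e \<in> uedges T" unfolding k(3) uedges_def by blast
    qed
  qed
  moreover have "inj_on (\<lambda>k. {f k, f (par k)}) {1..m}"
  proof (rule inj_onI)
    fix k l assume kl: "k \<in> {1..m}" "l \<in> {1..m}" "{f k, f (par k)} = {f l, f (par l)}"
    have p: "par k < k" "par l < l" using par kl by auto
    have "f ` {k, par k} = f ` {l, par l}" using kl(3) by simp
    moreover have "{k, par k} \<subseteq> {..m}" "{l, par l} \<subseteq> {..m}" using kl p by auto
    ultimately have "{k, par k} = {l, par l}" using inj_on_image_eq_iff[OF inj] by blast
    hence "k = l \<or> (k = par l \<and> par k = l)" by (simp only: doubleton_eq_iff) blast
    thus "k = l" using p by linarith
  qed
  ultimately have "card (uedges T) = m" by (simp add: card_image)
  thus ?thesis using S inj img arcs unfolding bij_betw_def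
    by (intro exI[of _ f] exI[of _ par]) auto
qed

section \<open>Random embeddings with uniform edges\<close>

context host begin

definition total :: real where "total = (\<Sum>v\<in>V. real (deg v))"

text \<open>
  The negative entropy allowed for the embedding of \<open>i\<close> edges. The first vertex is at \<open>v\<close> with probability
  \<open>deg v / total\<close>. Attaching a leaf to a tree with \<open>s\<close> edges then contributes the entropy of a uniform
  neighbour, diminished by the losses from avoiding \<open>s\<close> of its vertices; the vertex to which the leaf is
  attached is not a neighbour of itself.
\<close>

definition neg_entropy_bound :: "nat \<Rightarrow> real" where
  "neg_entropy_bound i = (\<Sum>v\<in>V. real (deg v) / total * (ln (real (deg v)) -
     (\<Sum>s<i. ln (real (deg v)) - (\<Sum>j<s. cost j v)))) - ln total"

text \<open>
  The invariant of the construction. A random embedding of the vertices \<open>0, \<dots>, i\<close> sends vertices to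
  \<open>v\<close> with probability \<open>deg v / total\<close> and edges to uniformly random arcs. Given an initial segment with \<open>n \<ge> 1\<close> edges of
  any chain, the next vertex of the chain takes each value with probability at most \<open>1 / (t - n)\<close>. The
  negative entropy is bounded as required.
\<close>

definition law :: "(nat \<Rightarrow> nat) \<Rightarrow> nat \<Rightarrow> ((nat \<Rightarrow> 'a) \<Rightarrow> real) \<Rightarrow> bool" where
  "law par i P \<longleftrightarrow> (\<forall>\<phi>. 0 \<le> P \<phi>) \<and> sum P ({..i} \<rightarrow>\<^sub>E V) = 1 \<and>
    (\<forall>\<phi>\<in>{..i} \<rightarrow>\<^sub>E V. P \<phi> \<noteq> 0 \<longrightarrow> inj_on \<phi> {..i} \<and> (\<forall>k. 1 \<le> k \<and> k \<le> i \<longrightarrow> \<phi> k \<in> N (\<phi> (par k)))) \<and>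
    (\<forall>k\<le>i. \<forall>\<alpha>. \<alpha> k \<in> V \<longrightarrow> marg {..i} P {k} \<alpha> = real (deg (\<alpha> k)) / total) \<and>
    (\<forall>k. 1 \<le> k \<and> k \<le> i \<longrightarrow> (\<forall>\<alpha>. \<alpha> k \<in> V \<longrightarrow> \<alpha> (par k) \<in> V \<longrightarrow>
       marg {..i} P {k, par k} \<alpha> = (if \<alpha> k \<in> N (\<alpha> (par k)) then 1 / total else 0))) \<and>
    (\<forall>a n \<alpha>. anc par a i \<longrightarrow> 1 \<le> n \<longrightarrow> Suc n \<le> i \<longrightarrow>
       marg {..i} P (set (take (Suc (Suc n)) (chain par i a))) \<alpha> \<le>
       marg {..i} P (set (take (Suc n) (chain par i a))) \<alpha> / real (t - n)) \<and>
    (\<Sum>\<phi>\<in>{..i} \<rightarrow>\<^sub>E V. xlnx (P \<phi>)) \<le> neg_entropy_bound i"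

lemma deg_pos: "v \<in> V \<Longrightarrow> 0 < deg v" using min_degree[of v] t_pos by simp

lemma total_pos: "V \<noteq> {} \<Longrightarrow> 0 < total"
  unfolding total_def using finite_V deg_pos by (intro sum_pos) auto

lemma law_0:
  assumes "V \<noteq> {}"
  shows "\<exists>P. law par 0 P"
proof -
  let ?P = "\<lambda>\<phi> :: nat \<Rightarrow> 'a. real (deg (\<phi> 0)) / total"
  have s: "(\<Sum>\<phi>\<in>{..0::nat} \<rightarrow>\<^sub>E V. g (\<phi> 0)) = (\<Sum>v\<in>V. g v)" for g :: "'a \<Rightarrow> real"
  proof -
    have "(\<Sum>\<phi>\<in>insert (0::nat) {} \<rightarrow>\<^sub>E V. g (\<phi> 0)) = (\<Sum>v\<in>V. g v)"
      by (subst sum_PiE_insert) auto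
    moreover have "{..0::nat} = insert 0 {}" by auto
    ultimately show ?thesis by (simp only:)
  qed
  have T: "0 < total" using total_pos[OF assms] .
  have one: "sum ?P ({..0} \<rightarrow>\<^sub>E V) = 1"
  proof -
    have "sum ?P ({..0} \<rightarrow>\<^sub>E V) = (\<Sum>v\<in>V. real (deg v) / total)" by (rule s)
    also have "\<dots> = total / total" unfolding total_def by (rule sum_divide_distrib[symmetric])
    finally show ?thesis using T by simp
  qed
  have m0: "marg {..0} ?P {0} \<alpha> = real (deg (\<alpha> 0)) / total" if "\<alpha> 0 \<in> V" for \<alpha>
  proof -
    have "marg {..0} ?P {0} \<alpha> = (\<Sum>\<phi>\<in>{..0::nat} \<rightarrow>\<^sub>E V. if \<phi> 0 = \<alpha> 0 then real (deg (\<phi> 0)) / total else 0)"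
      by (simp add: marg_alt)
    also have "\<dots> = (\<Sum>v\<in>V. if v = \<alpha> 0 then real (deg v) / total else 0)" by (rule s)
    finally show ?thesis using that finite_V by (simp add: sum.delta)
  qed
  have "(\<Sum>\<phi>\<in>{..0::nat} \<rightarrow>\<^sub>E V. xlnx (?P \<phi>)) = (\<Sum>v\<in>V. xlnx (real (deg v) / total))"
    using s[of "\<lambda>v. xlnx (real (deg v) / total)"] .
  also have "\<dots> = (\<Sum>v\<in>V. real (deg v) / total * ln (real (deg v)) - real (deg v) / total * ln total)"
    using deg_pos T by (intro sum.cong refl) (simp add: xlnx_def ln_div algebra_simps)
  also have "\<dots> = neg_entropy_bound 0"
    using T by (simp add: sum_subtractf neg_entropy_bound_def sum_distrib_right[symmetric] sum_divide_distrib[symmetric] total_def[symmetric])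
  finally have ent: "(\<Sum>\<phi>\<in>{..0} \<rightarrow>\<^sub>E V. xlnx (?P \<phi>)) \<le> neg_entropy_bound 0" by simp
  show ?thesis unfolding law_def using one m0 ent T
    by (intro exI[of _ ?P]) (simp add: inj_on_def)
qed

lemma marg_out: "k \<in> B \<Longrightarrow> k \<in> I \<Longrightarrow> \<alpha> k \<notin> V \<Longrightarrow> marg I P B \<alpha> = 0"
  unfolding marg_def
proof (rule sum.neutral, rule ballI)
  fix \<phi> assume "k \<in> B" "k \<in> I" "\<alpha> k \<notin> V" "\<phi> \<in> agree I B \<alpha>"
  hence "\<phi> \<in> I \<rightarrow>\<^sub>E V" "\<phi> k = \<alpha> k" unfolding agree_def by blast+
  thus "P \<phi> = 0" using PiE_mem[of \<phi> I "\<lambda>_. V" k] \<open>k \<in> I\<close> \<open>\<alpha> k \<notin> V\<close> by simp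
qed

lemma law_chainD:
  "law par i P \<Longrightarrow> anc par a i \<Longrightarrow> 1 \<le> n \<Longrightarrow> Suc n \<le> i \<Longrightarrow>
    marg {..i} P (set (take (Suc (Suc n)) (chain par i a))) \<alpha> \<le>
    marg {..i} P (set (take (Suc n) (chain par i a))) \<alpha> / real (t - n)"
  unfolding law_def by blast

text \<open>
  For the first vertex to be avoided, the required bound is the uniformity of edges: given the position
  of one end, the other end is uniform on its neighbours. For the later ones it is the bound along the chain from the parent.
\<close>

lemma law_extension:
  assumes "dfs par t" "i < t" "law par i P"
  shows "extension V N t {..i} P (\<lambda>k. chain par i (par (Suc i)) ! k) (Suc i)"
proof -
  define a where "a = par (Suc i)"
  define C where "C = chain par i a"
  have aL: "a < Suc i" "anc par a i" using assms(1,2) unfolding dfs_def a_def by auto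
  have C: "set C = {..i}" "distinct C" "length C = Suc i"
    using chain_props[OF assms(1), of i a] aL(1) assms(2) unfolding C_def by auto
  have C0: "C ! 0 = a" using chain_nth0[of a i par] aL by (simp add: C_def)
  have Tpos: "0 < total"
  proof (rule total_pos, rule notI)
    assume "V = {}"
    hence "{..i} \<rightarrow>\<^sub>E V = {}" by (simp add: PiE_eq_empty_iff) blast
    thus False using assms(3) unfolding law_def by simp
  qed
  have "extension V N t {..i} P (\<lambda>k. C ! k) (Suc i)"
  proof
    show "1 \<le> Suc i" "Suc i \<le> t" using assms(2) by auto
    show "inj_on (\<lambda>k. C ! k) {..<Suc i}" using C by (auto intro: inj_on_nth)
    show "(\<lambda>k. C ! k) ` {..<Suc i} = {..i}" using nth_image[of "Suc i" C] C by (simp add: atLeast0LessThan)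
    show "0 \<le> P \<phi>" for \<phi> using assms(3) unfolding law_def by blast
    show "sum P ({..i} \<rightarrow>\<^sub>E V) = 1" using assms(3) unfolding law_def by blast
    show "marg {..i} P ((\<lambda>k. C ! k) ` {..1}) \<alpha> \<le> marg {..i} P ((\<lambda>k. C ! k) ` {..0}) \<alpha> / real (deg (\<alpha> (C ! 0)))"
      if "2 \<le> Suc i" for \<alpha>
    proof -
      have "1 \<le> i" using that by simp
      from chain_nth1[OF assms(1) less_imp_le[OF assms(2)] aL(2) this]
      obtain k where k: "1 \<le> k" "k \<le> i" "{C ! 0, C ! 1} = {k, par k}"
        unfolding C_def by blast
      have e: "(\<lambda>k. C ! k) ` {..1} = {k, par k}" "(\<lambda>k. C ! k) ` {..0} = {a}"
        using k(3) C0 by (auto simp: atMost_Suc)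
      have pk: "par k \<le> i" using k assms unfolding dfs_def by force
      have a: "a \<in> {k, par k}" using k(3) C0 by auto
      show ?thesis
      proof (cases "\<alpha> k \<in> V \<and> \<alpha> (par k) \<in> V")
        case True
        hence "\<alpha> a \<in> V" using a by auto
        hence "marg {..i} P {a} \<alpha> = real (deg (\<alpha> a)) / total"
          using assms(3) aL(1) unfolding law_def by auto
        hence "marg {..i} P {a} \<alpha> / real (deg (\<alpha> a)) = 1 / total" using deg_pos[OF \<open>\<alpha> a \<in> V\<close>] by simp
        moreover have "marg {..i} P {k, par k} \<alpha> = (if \<alpha> k \<in> N (\<alpha> (par k)) then 1 / total else 0)"
          using True k(1,2) assms(3) unfolding law_def by blast
        hence "marg {..i} P {k, par k} \<alpha> \<le> 1 / total" using Tpos by simp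
        ultimately show ?thesis unfolding e C0 by linarith
      next
        case False
        hence "marg {..i} P {k, par k} \<alpha> = 0"
          using marg_out[of k "{k, par k}" "{..i}" \<alpha> P] marg_out[of "par k" "{k, par k}" "{..i}" \<alpha> P] k pk by auto
        moreover have "0 \<le> marg {..i} P {a} \<alpha>"
          unfolding marg_def using assms(3) unfolding law_def by (intro sum_nonneg) blast
        ultimately show ?thesis unfolding e by simp
      qed
    qed
    show "marg {..i} P ((\<lambda>k. C ! k) ` {..Suc n}) \<alpha> \<le> marg {..i} P ((\<lambda>k. C ! k) ` {..n}) \<alpha> / real (t - n)"
      if "1 \<le> n" "Suc n < Suc i" for n \<alpha>
    proof -
      have e: "(\<lambda>k. C ! k) ` {..Suc n} = set (take (Suc (Suc n)) C)" "(\<lambda>k. C ! k) ` {..n} = set (take (Suc n) C)"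
        using take_nth_image[of "Suc n" C] take_nth_image[of n C] that C by auto
      show ?thesis unfolding e unfolding C_def by (rule law_chainD[OF assms(3) aL(2)]) (use that in auto)
    qed
  qed
  thus ?thesis unfolding C_def a_def .
qed

lemma neg_entropy_bound_Suc:
  "neg_entropy_bound (Suc i) = neg_entropy_bound i + (\<Sum>v\<in>V. real (deg v) / total * ((\<Sum>j<i. cost j v) - ln (real (deg v))))"
proof -
  have "(\<Sum>v\<in>V. real (deg v) / total * (ln (real (deg v)) - (\<Sum>s<Suc i. ln (real (deg v)) - (\<Sum>j<s. cost j v)))) =
    (\<Sum>v\<in>V. real (deg v) / total * (ln (real (deg v)) - (\<Sum>s<i. ln (real (deg v)) - (\<Sum>j<s. cost j v)))) +
    (\<Sum>v\<in>V. real (deg v) / total * ((\<Sum>j<i. cost j v) - ln (real (deg v))))"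
    unfolding sum.distrib[symmetric] sum.lessThan_Suc distrib_left[symmetric]
    by (intro sum.cong refl arg_cong2[where f = "(*)"]) simp
  thus ?thesis unfolding neg_entropy_bound_def by simp
qed

text \<open>
  The vertex \<open>Suc i\<close> is attached to its parent \<open>a\<close>, and the other vertices are avoided in the order of the
  chain from \<open>a\<close>.
\<close>

lemma law_Suc:
  assumes "dfs par t" "i < t" "law par i P"
  shows "\<exists>P'. law par (Suc i) P'"
proof -
  define a where "a = par (Suc i)"
  define C where "C = chain par i a"
  have aL: "a < Suc i" "anc par a i" using assms(1,2) unfolding dfs_def a_def by auto
  have C: "set C = {..i}" "distinct C" "length C = Suc i"
    using chain_props[OF assms(1), of i a] aL(1) assms(2) unfolding C_def by auto
  have C0: "C ! 0 = a" using chain_nth0[of a i par] aL by (simp add: C_def)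
  interpret E: extension V N t "{..i}" P "\<lambda>k. C ! k" "Suc i"
    using law_extension[OF assms] unfolding C_def a_def .
  have EA: "E.A n = set (take (Suc n) C)" if "n < Suc i" for n
    unfolding E.A_def using take_nth_image[of n C] that C by simp
  let ?l = "Suc i"
  have l: "?l \<notin> {..i}" by simp
  have ins: "insert ?l {..i} = {..?l}" by (simp add: atMost_Suc)
  let ?P = "E.extend ?l"
  have old: "marg {..?l} ?P B \<alpha> = marg {..i} P B \<alpha>" if "B \<subseteq> {..i}" for B \<alpha>
    using E.extend_marg_old[OF l that] unfolding ins .
  have new: "marg {..?l} ?P (insert ?l (set (take (Suc n) C))) \<alpha> \<le> marg {..i} P (set (take (Suc n) C)) \<alpha> / real (t - n)"
    if "1 \<le> n" "n < Suc i" for n \<alpha>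
    using E.extend_bound_new[OF l that(2,1)] unfolding ins EA[OF that(2)] .
  have nxt: "marg {..?l} ?P (insert ?l (set (take (Suc n) C))) \<alpha> \<le> marg {..?l} ?P (insert ?l (set (take n C))) \<alpha> / real (t - n)"
    if n: "1 \<le> n" "n < Suc i" for n \<alpha>
  proof -
    obtain n' where n': "n = Suc n'" using n by (cases n) auto
    show ?thesis using E.extend_bound_next[OF l, of n' \<alpha>] n EA[of n'] EA[of n] unfolding ins n' by simp
  qed
  have vertex: "marg {..i} P {k} \<alpha> = real (deg (\<alpha> k)) / total" if "k \<le> i" "\<alpha> k \<in> V" for k \<alpha>
    using assms(3) that unfolding law_def by blast
  have edge_new: "marg {..?l} ?P {?l, a} \<alpha> = (if \<alpha> ?l \<in> N (\<alpha> a) then 1 / total else 0)"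
    if "\<alpha> ?l \<in> V" "\<alpha> a \<in> V" for \<alpha>
    using E.extend_edge[of ?l \<alpha>] l vertex[of a \<alpha>] deg_pos[OF that(2)] that aL(1) unfolding ins C0 by simp
  have vertex_new: "marg {..?l} ?P {?l} \<alpha> = real (deg (\<alpha> ?l)) / total" if "\<alpha> ?l \<in> V" for \<alpha>
  proof -
    \<comment> \<open>The new vertex has the right law because the arcs are counted equally from both ends.\<close>
    have "marg {..?l} ?P {?l} \<alpha> = (\<Sum>w\<in>V. marg {..?l} ?P {?l, a} (\<alpha>(a := w)))"
      unfolding marg_def using aL(1) sum_agree_split[of "{..?l}" a "{?l}" ?P \<alpha>] by (simp add: insert_commute)
    also have "\<dots> = (\<Sum>w\<in>V. if w \<in> N (\<alpha> ?l) then 1 / total else 0)"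
    proof (intro sum.cong refl)
      fix w assume w: "w \<in> V"
      show "marg {..?l} ?P {?l, a} (\<alpha>(a := w)) = (if w \<in> N (\<alpha> ?l) then 1 / total else 0)"
        using edge_new[of "\<alpha>(a := w)"] that w aL(1) N_sym[OF w that] by simp
    qed
    also have "\<dots> = (\<Sum>w\<in>N (\<alpha> ?l). 1 / total)"
      using N_sub[OF that] finite_V by (intro sum.mono_neutral_cong_right) auto
    finally show ?thesis by simp
  qed
  have support: "inj_on \<phi> {..?l} \<and> (\<forall>k. 1 \<le> k \<and> k \<le> ?l \<longrightarrow> \<phi> k \<in> N (\<phi> (par k)))" if "?P \<phi> \<noteq> 0" for \<phi>
  proof -
    note s = E.extend_support[OF l that, unfolded C0]
    have r: "inj_on (restrict \<phi> {..i}) {..i}"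
      "\<forall>k. 1 \<le> k \<and> k \<le> i \<longrightarrow> restrict \<phi> {..i} k \<in> N (restrict \<phi> {..i} (par k))"
      using s(1,2) assms(3) unfolding law_def by blast+
    have "inj_on \<phi> {..i}" using r(1) by (auto simp: inj_on_def)
    moreover have "{..i} - {?l} = {..i}" by auto
    ultimately have "inj_on \<phi> {..?l}" unfolding ins[symmetric] inj_on_insert using s(4) by simp
    moreover have "\<phi> k \<in> N (\<phi> (par k))" if "1 \<le> k" "k \<le> ?l" for k
    proof (cases "k = ?l")
      case False
      hence "k \<le> i" "par k < k" using that assms(1,2) unfolding dfs_def by auto
      thus ?thesis using r(2) that(1) by (metis atMost_iff le_trans less_imp_le restrict_apply')
    qed (use s(3) a_def in simp)
    ultimately show ?thesis by blast
  qed
  have chain_bound: "marg {..?l} ?P (set (take (Suc (Suc n)) (chain par ?l b))) \<alpha> \<le>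
       marg {..?l} ?P (set (take (Suc n) (chain par ?l b))) \<alpha> / real (t - n)"
    if b: "anc par b ?l" and n: "1 \<le> n" "Suc n \<le> ?l" for b n \<alpha>
  proof (cases "b = ?l")
    case True
    have "chain par ?l b = ?l # C" using chain_Suc_self[of par i] aL(1) True unfolding C_def a_def by simp
    thus ?thesis using nxt[of n \<alpha>] n by simp
  next
    case False
    hence ba: "anc par b a" using anc_cases[OF b] unfolding a_def by blast
    hence bi: "anc par b i" using anc_trans[OF aL(2)] by blast
    have bL: "b \<le> i" using anc_le[OF bi] .
    have shift: "set (take (Suc k) (chain par ?l b)) = insert ?l (set (take k C))" if "Suc i - b \<le> k" for k
      using chain_Suc_anc[of par b i k] ba aL(1) that unfolding a_def C_def by simp
    \<comment> \<open>The next vertex of the chain from \<open>b\<close> is an old descendant of \<open>b\<close>, the new vertex, or lies further up.\<close>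
    consider "Suc (Suc n) \<le> Suc i - b" | "Suc n = Suc i - b" | "Suc i - b < Suc n" by linarith
    thus ?thesis
    proof cases
      case 1
      have e: "take k (chain par ?l b) = take k (chain par i b)" if "k \<le> Suc i - b" for k
        using that bL unfolding chain_def by (simp add: take_upt del: upt_Suc)
      have "set (take k (chain par i b)) \<subseteq> {..i}" for k
        using set_take_subset[of k "chain par i b"] chain_props(1)[OF assms(1), of i b] assms(2) bL by simp
      hence "marg {..?l} ?P (set (take k (chain par i b))) \<alpha> = marg {..i} P (set (take k (chain par i b))) \<alpha>" for k
        by (rule old)
      moreover have "Suc n \<le> i" using 1 by simp
      ultimately show ?thesis
        using 1 e[of "Suc (Suc n)"] e[of "Suc n"] law_chainD[OF assms(3) bi n(1), of \<alpha>] by simp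
    next
      case 2
      have e: "take (Suc n) (chain par ?l b) = [b..<Suc i]" using 2 bL unfolding chain_def by simp
      have "chain par ?l b = [b..<Suc i] @ ?l # up par b" using bL by (simp add: chain_def)
      hence "set (take (Suc (Suc n)) (chain par ?l b)) = insert ?l {b..<Suc i}" using 2 by (simp add: Suc_diff_le del: upt_Suc)
      moreover have "set (take (Suc (Suc n)) (chain par ?l b)) = insert ?l (set (take (Suc n) C))"
        using shift[of "Suc n"] 2 by simp
      moreover have "set (take (Suc n) C) \<subseteq> {..i}" using set_take_subset[of "Suc n" C] C by simp
      ultimately have "set (take (Suc n) C) = {b..<Suc i}" using l
        by (metis Diff_insert_absorb atLeastLessThan_iff less_irrefl subsetD)
      hence s: "set (take (Suc n) (chain par ?l b)) = set (take (Suc n) C)"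
        "set (take (Suc (Suc n)) (chain par ?l b)) = insert ?l (set (take (Suc n) C))"
        using e shift[of "Suc n"] 2 by (simp_all del: upt_Suc)
      show ?thesis unfolding s old[OF \<open>set (take (Suc n) C) \<subseteq> {..i}\<close>] using new n by simp
    next
      case 3
      thus ?thesis using shift[of "Suc n"] shift[of n] nxt[of n \<alpha>] n by simp
    qed
  qed
  have ent: "(\<Sum>\<phi>\<in>{..?l} \<rightarrow>\<^sub>E V. xlnx (?P \<phi>)) \<le> neg_entropy_bound ?l"
  proof -
    have "(\<Sum>\<phi>\<in>{..?l} \<rightarrow>\<^sub>E V. xlnx (?P \<phi>)) \<le> (\<Sum>\<phi>\<in>{..i} \<rightarrow>\<^sub>E V. xlnx (P \<phi>)) +
      (\<Sum>v\<in>V. marg {..i} P {a} (\<lambda>_. v) * ((\<Sum>j<i. cost j v) - ln (real (deg v))))"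
      using E.extend_entropy[OF l] unfolding ins C0 by simp
    also have "(\<Sum>v\<in>V. marg {..i} P {a} (\<lambda>_. v) * ((\<Sum>j<i. cost j v) - ln (real (deg v)))) =
      (\<Sum>v\<in>V. real (deg v) / total * ((\<Sum>j<i. cost j v) - ln (real (deg v))))"
      using vertex[of a] aL(1) by (intro sum.cong refl) simp
    also have "(\<Sum>\<phi>\<in>{..i} \<rightarrow>\<^sub>E V. xlnx (P \<phi>)) \<le> neg_entropy_bound i" using assms(3) unfolding law_def by blast
    finally show ?thesis by (simp add: neg_entropy_bound_Suc)
  qed
  have edges: "marg {..?l} ?P {k, par k} \<alpha> = (if \<alpha> k \<in> N (\<alpha> (par k)) then 1 / total else 0)"
    if "1 \<le> k" "k \<le> ?l" "\<alpha> k \<in> V" "\<alpha> (par k) \<in> V" for k \<alpha>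
  proof (cases "k = ?l")
    case True thus ?thesis using edge_new that unfolding a_def by simp
  next
    case False
    hence k: "k \<le> i" "par k < k" using that assms(1,2) unfolding dfs_def by auto
    hence "marg {..?l} ?P {k, par k} \<alpha> = marg {..i} P {k, par k} \<alpha>" by (intro old) auto
    thus ?thesis using k(1) that assms(3) unfolding law_def by simp
  qed
  have vertices: "marg {..?l} ?P {k} \<alpha> = real (deg (\<alpha> k)) / total" if "k \<le> ?l" "\<alpha> k \<in> V" for k \<alpha>
    using vertex_new vertex[of k \<alpha>] old[of "{k}" \<alpha>] that by (cases "k = ?l") auto
  show ?thesis unfolding law_def
    using E.extend_nonneg[OF l] E.extend_one[OF l] support vertices edges chain_bound ent unfolding ins
    by (intro exI[of _ ?P] conjI allI ballI impI) auto
qed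

lemma law_exists: "V \<noteq> {} \<Longrightarrow> dfs par t \<Longrightarrow> i \<le> t \<Longrightarrow> \<exists>P. law par i P"
proof (induction i)
  case 0 thus ?case using law_0 by blast
next
  case (Suc i) thus ?case using law_Suc[of par i] by auto
qed

end

section \<open>Counting embeddings by entropy\<close>

text \<open>
  This is \<open>k! \<ge> e (k / e)^k\<close> after taking logarithms.
\<close>

lemma exp_power_le_fact: "1 \<le> k \<Longrightarrow> real k * ln (real k) - ln (fact k) \<le> real k - 1"
proof (induction k rule: nat_induct_at_least)
  case base show ?case by simp
next
  case (Suc k)
  hence k: "0 < real k" by simp
  have "ln (real (Suc k) / real k) \<le> real (Suc k) / real k - 1" using k by (intro ln_le_minus_one) auto
  hence "ln (real (Suc k)) - ln (real k) \<le> 1 / real k" using k by (simp add: ln_div field_simps)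
  hence "real k * (ln (real (Suc k)) - ln (real k)) \<le> real k * (1 / real k)" using k by (intro mult_left_mono) auto
  hence a: "real k * ln (real (Suc k)) - real k * ln (real k) \<le> 1" using k by (simp add: right_diff_distrib)
  have "ln (fact (Suc k) :: real) = ln (real (Suc k)) + ln (fact k)"
    unfolding fact_Suc by (subst ln_mult) auto
  moreover have "real (Suc k) * ln (real (Suc k)) = real k * ln (real (Suc k)) + ln (real (Suc k))"
    by (simp add: algebra_simps)
  ultimately show ?case using a Suc.IH by simp
qed

lemma sum_ln_descending: "(\<Sum>s<k. ln (real (k - s))) = ln (fact k)"
proof -
  have "(\<Sum>s<k. ln (real (k - s))) = (\<Sum>s<k. ln (real (Suc (k - Suc s))))"
    by (intro sum.cong refl) (simp only: Suc_diff_Suc lessThan_iff)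
  also have "\<dots> = (\<Sum>s<k. ln (real (Suc s)))"
    by (rule sum.nat_diff_reindex)
  also have "\<dots> = ln (fact k)"
  proof (induction k)
    case (Suc k)
    have "ln (fact (Suc k) :: real) = ln (real (Suc k)) + ln (fact k)"
      unfolding fact_Suc by (subst ln_mult) auto
    thus ?case using Suc by simp
  qed simp
  finally show ?thesis .
qed

definition tree_embeddings :: "'a set \<Rightarrow> ('a \<Rightarrow> 'a set) \<Rightarrow> nat \<Rightarrow> (nat \<Rightarrow> nat) \<Rightarrow> (nat \<Rightarrow> 'a) set" where
  "tree_embeddings V N t par = {\<phi> \<in> {..t} \<rightarrow>\<^sub>E V. inj_on \<phi> {..t} \<and> (\<forall>k. 1 \<le> k \<and> k \<le> t \<longrightarrow> \<phi> k \<in> N (\<phi> (par k)))}"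

context host begin

lemma cost_sum:
  assumes "v \<in> V" "Suc s < t"
  shows "(\<Sum>j<Suc s. cost j v) = ln (real (deg v)) - ln (real (deg v) - 1) +
    real (t - 1) / (real (deg v) - 1) * (ln (real (t - 1)) - ln (real (t - 1 - s)))"
  using assms(2)
proof (induction s)
  case 0
  have "2 \<le> deg v" using min_degree[OF assms(1)] 0 by simp
  thus ?case by (simp add: cost_def q_def cap_def ln_div)
next
  case (Suc s)
  have d: "2 \<le> deg v" using min_degree[OF assms(1)] Suc.prems by simp
  have e: "t - Suc s = t - 1 - s" "t - Suc s - 1 = t - 1 - Suc s" by auto
  have "cost (Suc s) v = real (t - 1) / (real (deg v) - 1) * ln (real (t - Suc s) / real (t - Suc s - 1))"
    using d Suc.prems by (simp add: cost_def q_def cap_def)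
  also have "ln (real (t - Suc s) / real (t - Suc s - 1)) = ln (real (t - 1 - s)) - ln (real (t - 1 - Suc s))"
    unfolding e using Suc.prems by (simp add: ln_div)
  finally show ?case using Suc by (simp add: algebra_simps)
qed

text \<open>
  With \<open>k = t - 1\<close> and \<open>e = deg v - 1\<close>, the losses add up to \<open>k / e * ln (k^k / k!) \<le> k (k - 1) / e\<close>, apart
  from the \<open>k\<close> terms that replace \<open>ln (deg v)\<close> by \<open>ln e\<close>. This is affordable because
  \<open>ln (e / (e - k + 1)) \<ge> (k - 1) / e\<close>.
\<close>

lemma step_entropies:
  assumes "v \<in> V"
  shows "ln (real (deg v)) + real (t - 1) * ln (real (deg v) - real t + 1) \<le>
    (\<Sum>s<t. ln (real (deg v)) - (\<Sum>j<s. cost j v))"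
proof (cases "t = 1")
  case False
  define k where "k = t - 1"
  define e where "e = real (deg v) - 1"
  have k: "1 \<le> k" "t = Suc k" using False t_pos by (auto simp: k_def)
  have e: "real k \<le> e" "0 < e" using min_degree[OF assms] k by (auto simp: e_def)
  have "(\<Sum>s<t. ln (real (deg v)) - (\<Sum>j<s. cost j v)) =
     ln (real (deg v)) + (\<Sum>s<k. ln (real (deg v)) - (\<Sum>j<Suc s. cost j v))"
    unfolding k(2) by (subst sum.lessThan_Suc_shift) simp
  also have "(\<Sum>s<k. ln (real (deg v)) - (\<Sum>j<Suc s. cost j v)) =
     (\<Sum>s<k. ln e - real k / e * (ln (real k) - ln (real (k - s))))"
    using cost_sum[OF assms] k(2) by (intro sum.cong refl) (simp add: e_def del: sum.lessThan_Suc)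
  also have "\<dots> = real k * ln e - real k / e * (real k * ln (real k) - ln (fact k))"
    unfolding sum_subtractf sum_distrib_left[symmetric] sum_ln_descending by simp
  finally have eq: "(\<Sum>s<t. ln (real (deg v)) - (\<Sum>j<s. cost j v)) =
     ln (real (deg v)) + (real k * ln e - real k / e * (real k * ln (real k) - ln (fact k)))" .
  have "real k / e * (real k * ln (real k) - ln (fact k)) \<le> real k / e * (real k - 1)"
    using exp_power_le_fact[OF k(1)] e by (intro mult_left_mono) auto
  moreover have "real k * ln (e - real k + 1) \<le> real k * ln e - real k / e * (real k - 1)"
  proof -
    have p: "0 < e - real k + 1" using e by simp
    have "ln ((e - real k + 1) / e) \<le> (e - real k + 1) / e - 1" using p e by (intro ln_le_minus_one) auto
    hence "ln (e - real k + 1) \<le> ln e - (real k - 1) / e" using p e by (simp add: ln_div field_simps)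
    hence "real k * ln (e - real k + 1) \<le> real k * (ln e - (real k - 1) / e)" by (intro mult_left_mono) auto
    thus ?thesis by (simp add: algebra_simps)
  qed
  moreover have "real (deg v) - real t + 1 = e - real k + 1" using k by (simp add: e_def)
  moreover have "real (t - 1) = real k" by (simp add: k_def)
  ultimately show ?thesis unfolding eq by simp
qed simp

text \<open>
  The entropy of a random embedding is at most the logarithm of the number of embeddings. The first vertex and
  the first attachment, which is the term \<open>s = 0\<close>, together contribute \<open>ln total\<close>, the entropy of a random arc.
\<close>

lemma card_embeddings:
  assumes "V \<noteq> {}" "dfs par t"
  shows "total * (\<Prod>v\<in>V. (real (deg v) - real t + 1) powr ((real t - 1) * real (deg v) / total))
    \<le> real (card (tree_embeddings V N t par))"
proof -
  obtain P where P: "law par t P" using law_exists[OF assms] by blast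
  note P' = P[unfolded law_def]
  let ?E = "tree_embeddings V N t par"
  have fin: "finite ({..t} \<rightarrow>\<^sub>E V)" using finite_V by (intro finite_PiE) auto
  have E: "?E \<subseteq> {..t} \<rightarrow>\<^sub>E V" unfolding tree_embeddings_def by blast
  hence finE: "finite ?E" using fin by (rule finite_subset)
  have out: "P \<phi> = 0" if "\<phi> \<in> ({..t} \<rightarrow>\<^sub>E V) - ?E" for \<phi>
    using P' that unfolding tree_embeddings_def by blast
  have one: "sum P ?E = 1" using sum.mono_neutral_right[OF fin E, of P] out P' by auto
  have "(\<Sum>\<phi>\<in>{..t} \<rightarrow>\<^sub>E V. xlnx (P \<phi>)) = (\<Sum>\<phi>\<in>?E. xlnx (P \<phi>))"
    using out by (intro sum.mono_neutral_right fin E) simp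
  hence ent: "(\<Sum>\<phi>\<in>?E. xlnx (P \<phi>)) \<le> neg_entropy_bound t" using P' by simp
  define K where "K = real (card ?E)"
  have "?E \<noteq> {}" using one by auto
  hence K: "0 < K" using finE by (simp add: K_def card_gt_0_iff)
  \<comment> \<open>The tangent at the uniform probability \<open>1 / K\<close>.\<close>
  have "(\<Sum>\<phi>\<in>?E. xlnx (1 / K) + (1 + ln (1 / K)) * (P \<phi> - 1 / K)) \<le> (\<Sum>\<phi>\<in>?E. xlnx (P \<phi>))"
    using P' K by (intro sum_mono xlnx_tangent) auto
  also have "(\<Sum>\<phi>\<in>?E. xlnx (1 / K) + (1 + ln (1 / K)) * (P \<phi> - 1 / K)) = - ln K"
    using K one by (simp add: sum.distrib sum_distrib_left[symmetric] sum_subtractf K_def[symmetric] xlnx_def ln_div)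
  finally have lnK: "- neg_entropy_bound t \<le> ln K" using ent by simp
  have T: "0 < total" using total_pos assms(1) by simp
  have pos: "0 < real (deg v) - real t + 1" if "v \<in> V" for v using min_degree[OF that] by simp
  let ?S = "\<Sum>v\<in>V. real (deg v) / total * (real (t - 1) * ln (real (deg v) - real t + 1))"
  have "(\<Sum>v\<in>V. real (deg v) / total * (ln (real (deg v)) - (\<Sum>s<t. ln (real (deg v)) - (\<Sum>j<s. cost j v))))
     \<le> (\<Sum>v\<in>V. real (deg v) / total * (- (real (t - 1) * ln (real (deg v) - real t + 1))))"
    using step_entropies T by (intro sum_mono mult_left_mono) (auto simp: algebra_simps)
  hence "neg_entropy_bound t \<le> - ?S - ln total" by (simp add: neg_entropy_bound_def sum_negf)
  hence "ln total + ?S \<le> ln K" using lnK by simp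
  hence "exp (ln total + ?S) \<le> exp (ln K)" by simp
  hence "total * exp ?S \<le> K" using T K by (simp add: exp_add)
  also have "exp ?S = (\<Prod>v\<in>V. (real (deg v) - real t + 1) powr ((real t - 1) * real (deg v) / total))"
  proof -
    have "exp (real (deg v) / total * (real (t - 1) * ln (real (deg v) - real t + 1))) =
      (real (deg v) - real t + 1) powr ((real t - 1) * real (deg v) / total)" if "v \<in> V" for v
      using pos[OF that] t_pos unfolding powr_def by (simp add: of_nat_diff mult_ac)
    thus ?thesis unfolding exp_sum[OF finite_V] by (intro prod.cong refl)
  qed
  finally show ?thesis unfolding K_def .
qed

end

section \<open>Labelled copies of a tree in a graph\<close>

lemma card_tree_embeddings_le:
  assumes "pair_graph G" "pair_graph T" and f: "bij_betw f {..t} (pverts T)"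
    and par: "\<And>k. 1 \<le> k \<Longrightarrow> k \<le> t \<Longrightarrow> par k < k"
    and arcs: "\<And>u v. (u, v) \<in> parcs T \<Longrightarrow> \<exists>k. 1 \<le> k \<and> k \<le> t \<and> {u, v} = {f k, f (par k)}"
  shows "card (tree_embeddings (pverts G) (\<lambda>v. {w. (v, w) \<in> parcs G}) t par) \<le> card (labeled_copies T G)"
proof -
  interpret G: pair_graph G by fact
  interpret T: pair_graph T by fact
  define g where "g = inv_into {..t} f"
  have gf: "g (f k) = k" if "k \<le> t" for k
    using f that unfolding g_def by (auto simp: bij_betw_def)
  have g_in: "g u \<le> t" "f (g u) = u" if "u \<in> pverts T" for u
  proof -
    have u: "u \<in> f ` {..t}" using f that by (simp add: bij_betw_def)
    show "g u \<le> t" using inv_into_into[OF u] unfolding g_def by simp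
    show "f (g u) = u" using f_inv_into_f[OF u] unfolding g_def .
  qed
  let ?c = "\<lambda>\<phi>. \<lambda>u\<in>pverts T. \<phi> (g u)"
  have symG: "(a, b) \<in> parcs G \<Longrightarrow> (b, a) \<in> parcs G" for a b
    using G.pair_sym_arcs symD[of "parcs G" a b] by (simp add: symmetric_def)
  show ?thesis
  proof (rule card_inj_on_le)
    show "finite (labeled_copies T G)"
      by (rule finite_subset[of _ "pverts T \<rightarrow>\<^sub>E pverts G"]) (auto simp: labeled_copies_def intro!: finite_PiE)
    show "inj_on ?c (tree_embeddings (pverts G) (\<lambda>v. {w. (v, w) \<in> parcs G}) t par)"
    proof (rule inj_onI)
      fix \<phi> \<psi> assume *: "\<phi> \<in> tree_embeddings (pverts G) (\<lambda>v. {w. (v, w) \<in> parcs G}) t par"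
        "\<psi> \<in> tree_embeddings (pverts G) (\<lambda>v. {w. (v, w) \<in> parcs G}) t par" "?c \<phi> = ?c \<psi>"
      have "\<phi> k = \<psi> k" if "k \<in> {..t}" for k
      proof -
        have "f k \<in> pverts T" using f that by (auto simp: bij_betw_def)
        thus ?thesis using fun_cong[OF *(3), of "f k"] gf that by simp
      qed
      thus "\<phi> = \<psi>" using *(1,2) unfolding tree_embeddings_def by (auto intro: PiE_ext)
    qed
    show "?c ` tree_embeddings (pverts G) (\<lambda>v. {w. (v, w) \<in> parcs G}) t par \<subseteq> labeled_copies T G"
    proof
      fix \<psi> assume "\<psi> \<in> ?c ` tree_embeddings (pverts G) (\<lambda>v. {w. (v, w) \<in> parcs G}) t par"
      then obtain \<phi> where \<phi>: "\<phi> \<in> {..t} \<rightarrow>\<^sub>E pverts G" "inj_on \<phi> {..t}"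
        "\<And>k. 1 \<le> k \<Longrightarrow> k \<le> t \<Longrightarrow> (\<phi> (par k), \<phi> k) \<in> parcs G" "\<psi> = ?c \<phi>"
        unfolding tree_embeddings_def by auto
      have "\<psi> \<in> pverts T \<rightarrow>\<^sub>E pverts G" unfolding \<phi>(4)
        by (rule restrict_PiE_iff[THEN iffD2], rule ballI) (rule PiE_mem[OF \<phi>(1)], simp add: g_in(1))
      moreover have "inj_on \<psi> (pverts T)"
      proof (rule inj_onI)
        fix u v assume "u \<in> pverts T" "v \<in> pverts T" "\<psi> u = \<psi> v"
        hence "\<phi> (g u) = \<phi> (g v)" unfolding \<phi>(4) by simp
        hence "g u = g v" using \<open>u \<in> pverts T\<close> \<open>v \<in> pverts T\<close> by (intro inj_onD[OF \<phi>(2)]) (simp_all add: g_in)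
        hence "f (g u) = f (g v)" by simp
        thus "u = v" using \<open>u \<in> pverts T\<close> \<open>v \<in> pverts T\<close> by (simp only: g_in(2))
      qed
      moreover have "(\<psi> u, \<psi> v) \<in> parcs G" if uv: "(u, v) \<in> parcs T" for u v
      proof -
        obtain k where k: "1 \<le> k" "k \<le> t" "{u, v} = {f k, f (par k)}" using arcs[OF uv] by blast
        have uvT: "u \<in> pverts T" "v \<in> pverts T" using T.in_arcsD1[OF uv] T.in_arcsD2[OF uv] by auto
        have e: "(\<phi> (par k), \<phi> k) \<in> parcs G" using \<phi>(3) k by blast
        have g: "g (f k) = k" "g (f (par k)) = par k" using gf[of k] gf[of "par k"] k par[of k] by simp_all
        have \<psi>: "\<psi> u = \<phi> (g u)" "\<psi> v = \<phi> (g v)" using uvT unfolding \<phi>(4) by simp_all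
        from k(3) consider "u = f k" "v = f (par k)" | "u = f (par k)" "v = f k"
          unfolding doubleton_eq_iff by blast
        thus ?thesis
        proof cases
          case 1 show ?thesis unfolding \<psi> unfolding 1 g by (rule symG[OF e])
        next
          case 2 show ?thesis unfolding \<psi> unfolding 2 g by (rule e)
        qed
      qed
      ultimately show "\<psi> \<in> labeled_copies T G" unfolding labeled_copies_def by auto
    qed
  qed
qed

lemma vdegree_eq_card: "vdegree G v = card {w. (v, w) \<in> parcs G}"
proof -
  have "out_arcs (with_proj G) v = Pair v ` {w. (v, w) \<in> parcs G}"
    unfolding out_arcs_def with_proj_simps by auto
  thus ?thesis unfolding out_degree_def by (simp add: card_image inj_on_def)
qed

text \<open>
  The bound for a tree without edges. The tangent to \<open>ln\<close> at the average \<open>sum \<delta> V / card V\<close> bounds each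
  \<open>ln (\<delta> v + 1)\<close> from below, and \<open>\<delta> v / (\<delta> v + 1) \<le> 1\<close> takes care of the linear terms.
\<close>

lemma vertex_weight_bound:
  fixes \<delta> :: "'a \<Rightarrow> real"
  assumes "finite V" "\<And>v. v \<in> V \<Longrightarrow> 0 \<le> \<delta> v" "0 < sum \<delta> V"
  shows "sum \<delta> V * (\<Prod>v\<in>V. (\<delta> v + 1) powr (- \<delta> v / sum \<delta> V)) \<le> real (card V)"
proof -
  define D where "D = sum \<delta> V"
  define n where "n = real (card V)"
  have D: "0 < D" using assms(3) by (simp add: D_def)
  hence "V \<noteq> {}" by (auto simp: D_def)
  hence n: "0 < n" using assms(1) by (simp add: n_def card_gt_0_iff)
  have "\<delta> v / D * (ln (D / n) + 1) - 1 / n \<le> \<delta> v / D * ln (\<delta> v + 1)" if v: "v \<in> V" for v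
  proof -
    have p: "0 < \<delta> v + 1" using assms(2)[OF v] by simp
    have "ln (D / n / (\<delta> v + 1)) \<le> D / n / (\<delta> v + 1) - 1"
      using D n p by (intro ln_le_minus_one) auto
    moreover have "ln (D / n / (\<delta> v + 1)) = ln (D / n) - ln (\<delta> v + 1)"
      using D n p by (intro ln_divide_pos) auto
    ultimately have "ln (D / n) + 1 - D / n / (\<delta> v + 1) \<le> ln (\<delta> v + 1)" by linarith
    hence "\<delta> v / D * (ln (D / n) + 1 - D / n / (\<delta> v + 1)) \<le> \<delta> v / D * ln (\<delta> v + 1)"
      using assms(2)[OF v] D by (intro mult_left_mono) auto
    moreover have "\<delta> v / D * (D / n / (\<delta> v + 1)) \<le> 1 / n"
    proof -
      have "\<delta> v / (\<delta> v + 1) \<le> 1" using p by simp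
      hence "\<delta> v / (\<delta> v + 1) / n \<le> 1 / n" using n by (intro divide_right_mono) auto
      thus ?thesis using D by (simp add: mult.commute)
    qed
    ultimately show ?thesis by (simp add: right_diff_distrib)
  qed
  hence "(\<Sum>v\<in>V. \<delta> v / D * (ln (D / n) + 1) - 1 / n) \<le> (\<Sum>v\<in>V. \<delta> v / D * ln (\<delta> v + 1))"
    by (rule sum_mono)
  moreover have "(\<Sum>v\<in>V. \<delta> v / D * (ln (D / n) + 1) - 1 / n) = ln (D / n)"
    using D n unfolding sum_subtractf sum_distrib_right[symmetric] sum_divide_distrib[symmetric]
    by (simp add: D_def[symmetric] n_def[symmetric])
  ultimately have "ln D - (\<Sum>v\<in>V. \<delta> v / D * ln (\<delta> v + 1)) \<le> ln n" using D n by (simp add: ln_div)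
  hence "exp (ln D + (\<Sum>v\<in>V. - \<delta> v / D * ln (\<delta> v + 1))) \<le> exp (ln n)" by (simp add: sum_negf)
  hence "D * exp (\<Sum>v\<in>V. - \<delta> v / D * ln (\<delta> v + 1)) \<le> n" using D n by (simp add: exp_add)
  moreover have "exp (\<Sum>v\<in>V. - \<delta> v / D * ln (\<delta> v + 1)) = (\<Prod>v\<in>V. (\<delta> v + 1) powr (- \<delta> v / D))"
    unfolding exp_sum[OF assms(1)]
  proof (intro prod.cong refl)
    fix v assume "v \<in> V"
    thus "exp (- \<delta> v / D * ln (\<delta> v + 1)) = (\<delta> v + 1) powr (- \<delta> v / D)"
      using assms(2)[of v] by (simp add: powr_def)
  qed
  ultimately show ?thesis by (simp add: D_def n_def)
qed

theorem theorem1: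
  fixes T :: "'b pair_pre_digraph" and G :: "'a pair_pre_digraph"
    and t n :: nat and d :: real
  assumes "undirected_tree T" and "card (uedges T) = t"
    and "pair_graph G" and "card (pverts G) = n" and "average_degree G = d"
    and "\<forall>v \<in> pverts G. vdegree G v \<ge> t"
  shows "real (card (labeled_copies T G)) \<ge>
    real n * d *
      (\<Prod>v \<in> pverts G.
         (real (vdegree G v) - real t + 1) powr
           ((real t - 1) * real (vdegree G v) / (real n * d)))"
proof (cases "pverts G = {}")
  case True
  thus ?thesis using assms(4) by simp
next
  case False
  interpret pair_graph G by fact
  define N where "N v = {w. (v, w) \<in> parcs G}" for v
  have deg: "vdegree G v = card (N v)" for v unfolding N_def by (rule vdegree_eq_card)
  have finV: "finite (pverts G)" by simp
  have "n \<noteq> 0" using False finV assms(4) by auto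
  hence nd: "real n * d = (\<Sum>v\<in>pverts G. real (card (N v)))"
    using assms(4,5) unfolding average_degree_def deg by auto
  obtain f par where f: "dfs par t" "bij_betw f {..t} (pverts T)"
    "\<And>u v. (u, v) \<in> parcs T \<Longrightarrow> \<exists>k. 1 \<le> k \<and> k \<le> t \<and> {u, v} = {f k, f (par k)}"
    using tree_depth_first_order[OF assms(1)] unfolding assms(2) by blast
  have "pair_graph T" using assms(1) unfolding undirected_tree_def by blast
  moreover have "par k < k" if "1 \<le> k" "k \<le> t" for k using f(1) that unfolding dfs_def by blast
  ultimately have copies: "card (tree_embeddings (pverts G) N t par) \<le> card (labeled_copies T G)"
    unfolding N_def by (rule card_tree_embeddings_le[OF assms(3) _ f(2) _ f(3)])
  show ?thesis
  proof (cases "t = 0")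
    case True
    have "tree_embeddings (pverts G) N t par = {0} \<rightarrow>\<^sub>E pverts G"
      unfolding tree_embeddings_def True by auto
    hence "card (tree_embeddings (pverts G) N t par) = n"
      using assms(4) by (simp add: card_PiE)
    hence n: "real n \<le> real (card (labeled_copies T G))" using copies by simp
    show ?thesis
    proof (cases "real n * d = 0")
      case False
      hence "0 < (\<Sum>v\<in>pverts G. real (card (N v)))"
        unfolding nd by (simp add: less_le sum_nonneg)
      from vertex_weight_bound[OF finV _ this] n show ?thesis
        unfolding nd deg True using assms(4) by simp
    next
      case True
      thus ?thesis by (simp only: mult_zero_left of_nat_0_le_iff)
    qed
  next
    case pos: False
    interpret H: host "pverts G" N t
    proof
      show "finite (pverts G)" by simp
      show "N v \<subseteq> pverts G" if "v \<in> pverts G" for v using in_arcsD2 unfolding N_def by blast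
      show "u \<in> N v \<longleftrightarrow> v \<in> N u" if "u \<in> pverts G" "v \<in> pverts G" for u v
        using pair_sym_arcs symD[of "parcs G" u v] symD[of "parcs G" v u] unfolding N_def
        by (auto simp: symmetric_def)
      show "v \<notin> N v" for v using pair_no_loops[of "(v, v)"] unfolding N_def by auto
      show "1 \<le> t" using pos by simp
      show "t \<le> card (N v)" if "v \<in> pverts G" for v using assms(6) that unfolding deg by blast
    qed
    have "real n * d * (\<Prod>v\<in>pverts G. (real (card (N v)) - real t + 1) powr
        ((real t - 1) * real (card (N v)) / (real n * d))) \<le> real (card (tree_embeddings (pverts G) N t par))"
      using H.card_embeddings[OF False f(1)] unfolding H.total_def nd .
    thus ?thesis unfolding deg using copies by simp
  qed
qed

end
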